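(* For every composition $\alpha$, $$\mathfrak{L}^{(\beta)}_\alpha=\sum_{\substack{T\in \mathrm{RSSYT}_{\alpha^+}\\ K_-(T)\le \alpha}}x^{\mathrm{wt}(T)}\prod_{(s,k)}(1+\beta x_k),$$ where, for each $T$, the product runs over all pairs $(s,k)$ such that $s$ is a box of $\alpha^+$, $k$ is a positive integer with $k<T(s)$, and replacing the entry of $T$ in box $s$ by $k$ results in a RSSYT.
   Context: A composition is a sequence $\alpha=(\alpha_1,\alpha_2,\dots)$ of nonnegative integers, almost all zero; $\alpha^+$ is the partition obtained by sorting it; $s_i\alpha$ swaps $\alpha_i,\alpha_{i+1}$; $x^\alpha=\prod_i x_i^{\alpha_i}$. Lascoux polynomials. On $R=\mathbb{Z}[\beta][x_1,x_2,\dots]$ let $s_i$ swap $x_i,x_{i+1}$, $\partial_i(f)=(f-s_i f)/(x_i-x_{i+1})$ and $\pi^{(\beta)}_i(f)=\partial_i\big((1+\beta x_{i+1})x_i f\big)$; these satisfy the braid relations. Define $\mathfrak{L}^{(\beta)}_\alpha=x^\alpha$ if $\alpha$ is a partition and $\mathfrak{L}^{(\beta)}_\alpha=\pi^{(\beta)}_i(\mathfrak{L}^{(\beta)}_{s_i\alpha})$ if $\alpha_i<\alpha_{i+1}$. Tableaux. Partition shapes are drawn in English notation. A reverse semistandard Young tableau (RSSYT) is a filling by positive integers weakly decreasing along rows from left to right and strictly decreasing down columns; $\mathrm{RSSYT}_\lambda$ is the set of those of shape $\lambda$. $\mathrm{wt}(T)$ is the composition whose $i$-th part is the number of occurrences of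 $i$ in $T$. Left key of an RSSYT. Columns are identified with their sets of entries. If $C_1C_2$ are two adjacent columns of an RSSYT and $C_2=\{a_1<\dots<a_m\}$, let $b_1$ be the smallest element of $C_1$ with $b_1\ge a_1$, and recursively let $b_j$ be the smallest element of $C_1$ with $b_j\ge a_j$ and $b_j>b_{j-1}$; put $C_1\triangleleft C_2=\{b_1<\dots<b_m\}$. For columns $C_1,\dots,C_k$ of an RSSYT put $C_1\triangleleft\cdots\triangleleft C_k=C_1\triangleleft(C_2\triangleleft\cdots\triangleleft C_k)$. If $T$ is an RSSYT with columns $C_1,C_2,\dots$, the left key $K_-(T)$ is the tableau whose $k$-th column is $C_1\triangleleft\cdots\triangleleft C_k$. It is a key tableau (each column, as a set, contains the next), and is identified with the composition $\mathrm{wt}(K_-(T))$. Order. For a composition $\alpha$, $\mathrm{key}(\alpha)$ is the key tableau whose $j$-th column is $\{i:\alpha_i\ge j\}$. For compositions, $\alpha\le\gamma$ means $\alpha^+=\gamma^+$ and, for every $j$ and $r$, the $r$-th smallest element of column $j$ of $\mathrm{key}(\alpha)$ is at most the $r$-th smallest element of column $j$ of $\mathrm{key}(\gamma)$. *)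

theory Defs
  imports
    "HOL-Library.Poly_Mapping"
    "HOL-Library.FuncSet"
    "HOL-Computational_Algebra.Polynomial"
    "HOL-Combinatorics.Transposition"
begin

text \<open>
  Indexing convention: the positive integers are represented by the type \<^typ>\<open>nat\<close>, with
  \<open>n :: nat\<close> standing for the positive integer \<open>n + 1\<close>.  This is used uniformly for the
  positions of the parts of a composition, the indices of the variables, the entries of
  tableaux, and the row and column numbers of boxes.  Thus a composition is exactly an element of
  \<^typ>\<open>nat \<Rightarrow>\<^sub>0 nat\<close>, and every \<open>k :: nat\<close> is a legitimate entry of a tableau.
  The values of the parts (including the threshold \<open>j\<close> in \<open>key_column\<close>) are not shifted.
\<close>

type_synonym composition = "nat \<Rightarrow>\<^sub>0 nat"

text \<open>
  The ring of polynomials in the infinitely many variables over the integer polynomials in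
  \<open>\<beta>\<close>: finitely supported functions from exponents to coefficients, with the convolution
  product of \<^theory>\<open>HOL-Library.Poly_Mapping\<close>.
\<close>

type_synonym beta_mpoly = "composition \<Rightarrow>\<^sub>0 int poly"

definition beta :: beta_mpoly where
  "beta = Poly_Mapping.single 0 [:0, 1:]"

definition monomial :: "composition \<Rightarrow> beta_mpoly" where
  "monomial \<alpha> = Poly_Mapping.single \<alpha> 1"

definition var :: "nat \<Rightarrow> beta_mpoly" where
  "var i = monomial (Poly_Mapping.single i 1)"


definition is_partition :: "composition \<Rightarrow> bool" where
  "is_partition \<alpha> \<longleftrightarrow>
     (\<forall>i. Poly_Mapping.lookup \<alpha> (Suc i) \<le> Poly_Mapping.lookup \<alpha> i)"

definition sort_comp :: "composition \<Rightarrow> composition" where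
  "sort_comp \<alpha> = Poly_Mapping.nth
     (rev (sort (map (Poly_Mapping.lookup \<alpha>) (sorted_list_of_set (Poly_Mapping.keys \<alpha>)))))"

definition swap_comp :: "nat \<Rightarrow> composition \<Rightarrow> composition" where
  "swap_comp i \<alpha> = Poly_Mapping.map_key (transpose i (Suc i)) \<alpha>"


subsection \<open>Lascoux polynomials\<close>

lemma inj_swap_comp: "inj (swap_comp i)"
proof (rule inj_on_inverseI)
  fix \<alpha> :: composition
  have "inj (transpose i (Suc i))" by simp
  then show "swap_comp i (swap_comp i \<alpha>) = \<alpha>"
    by (intro poly_mapping_eqI) (simp add: swap_comp_def Poly_Mapping.map_key.rep_eq)
qed

text \<open>
  Exchanging two variables permutes the exponents: the coefficient of the monomial with exponent
  \<open>\<alpha>\<close> in \<open>swap_vars i f\<close> is that of the monomial with exponent \<open>swap_comp i \<alpha>\<close> in \<open>f\<close>.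
  The lemmas confirm that the library's \<open>map_key\<close>, which is specified for injective maps
  only, is used within its range of specification.
\<close>

definition swap_vars :: "nat \<Rightarrow> beta_mpoly \<Rightarrow> beta_mpoly" where
  "swap_vars i f = Poly_Mapping.map_key (swap_comp i) f"

lemma lookup_swap_comp:
  "Poly_Mapping.lookup (swap_comp i \<alpha>) j = Poly_Mapping.lookup \<alpha> (transpose i (Suc i) j)"
  by (simp add: swap_comp_def Poly_Mapping.map_key.rep_eq)

lemma lookup_swap_vars:
  "Poly_Mapping.lookup (swap_vars i f) \<alpha> = Poly_Mapping.lookup f (swap_comp i \<alpha>)"
  by (simp add: swap_vars_def Poly_Mapping.map_key.rep_eq inj_swap_comp)

text \<open>The exact quotient; it is unique because the ring is an integral domain.\<close>

definition divided_diff :: "nat \<Rightarrow> beta_mpoly \<Rightarrow> beta_mpoly" where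
  "divided_diff i f = (THE g. g * (var i - var (Suc i)) = f - swap_vars i f)"

definition demazure_lascoux :: "nat \<Rightarrow> beta_mpoly \<Rightarrow> beta_mpoly" where
  "demazure_lascoux i f = divided_diff i ((1 + beta * var (Suc i)) * var i * f)"

text \<open>
  The recursion for Lascoux polynomials does not prescribe which ascent is used, so it is
  rendered as a system of equations, holding for every ascent, on the whole family.  The system
  has a unique solution: existence is due to the braid relations, uniqueness to the fact that
  each step removes an inversion.
\<close>

definition lascoux_family :: "(composition \<Rightarrow> beta_mpoly) \<Rightarrow> bool" where
  "lascoux_family L \<longleftrightarrow>
     (\<forall>\<alpha>. is_partition \<alpha> \<longrightarrow> L \<alpha> = monomial \<alpha>) \<and>
     (\<forall>\<alpha> i. Poly_Mapping.lookup \<alpha> i < Poly_Mapping.lookup \<alpha> (Suc i) \<longrightarrow>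
        L \<alpha> = demazure_lascoux i (L (swap_comp i \<alpha>)))"

definition lascoux :: "composition \<Rightarrow> beta_mpoly" where
  "lascoux = (THE L. lascoux_family L)"


subsection \<open>Tableaux\<close>

text \<open>
  Boxes are pairs of a row and a column.  A filling is a function that is \<open>undefined\<close> outside
  the boxes, so that distinct fillings are distinct functions.
\<close>

definition boxes :: "composition \<Rightarrow> (nat \<times> nat) set" where
  "boxes \<mu> = {(r, c). c < Poly_Mapping.lookup \<mu> r}"

definition RSSYT :: "composition \<Rightarrow> (nat \<times> nat \<Rightarrow> nat) set" where
  "RSSYT \<mu> = {T \<in> boxes \<mu> \<rightarrow>\<^sub>E UNIV.
     (\<forall>r c. (r, Suc c) \<in> boxes \<mu> \<longrightarrow> T (r, Suc c) \<le> T (r, c)) \<and>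
     (\<forall>r c. (Suc r, c) \<in> boxes \<mu> \<longrightarrow> T (Suc r, c) < T (r, c))}"

definition wt :: "composition \<Rightarrow> (nat \<times> nat \<Rightarrow> nat) \<Rightarrow> composition" where
  "wt \<mu> T = (\<Sum>s\<in>boxes \<mu>. Poly_Mapping.single (T s) 1)"


subsection \<open>The left key\<close>

definition column :: "composition \<Rightarrow> (nat \<times> nat \<Rightarrow> nat) \<Rightarrow> nat \<Rightarrow> nat set" where
  "column \<mu> T c = {T (r, c) |r. (r, c) \<in> boxes \<mu>}"

primrec tri_elem :: "nat set \<Rightarrow> nat set \<Rightarrow> nat \<Rightarrow> nat" where
  "tri_elem C1 C2 0 = (LEAST b. b \<in> C1 \<and> sorted_list_of_set C2 ! 0 \<le> b)"
| "tri_elem C1 C2 (Suc j) =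
     (LEAST b. b \<in> C1 \<and> sorted_list_of_set C2 ! Suc j \<le> b \<and> tri_elem C1 C2 j < b)"

definition tri :: "nat set \<Rightarrow> nat set \<Rightarrow> nat set" (infixr \<open>\<triangleleft>\<close> 65) where
  "C1 \<triangleleft> C2 = tri_elem C1 C2 ` {..<card C2}"

text \<open>Only nonempty lists of columns matter.\<close>

fun tri_list :: "nat set list \<Rightarrow> nat set" where
  "tri_list [] = {}"
| "tri_list [C] = C"
| "tri_list (C # D # Cs) = C \<triangleleft> tri_list (D # Cs)"

definition left_key_column :: "composition \<Rightarrow> (nat \<times> nat \<Rightarrow> nat) \<Rightarrow> nat \<Rightarrow> nat set" where
  "left_key_column \<mu> T c = tri_list (map (column \<mu> T) [0..<Suc c])"

text \<open>
  As \<open>C1 \<triangleleft> C2\<close> has as many elements as \<open>C2\<close>, the left key has the same shape as \<open>T\<close>; its columns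
  are read off in decreasing order.
\<close>

definition left_key :: "composition \<Rightarrow> (nat \<times> nat \<Rightarrow> nat) \<Rightarrow> (nat \<times> nat \<Rightarrow> nat)" where
  "left_key \<mu> T =
     (\<lambda>(r, c)\<in>boxes \<mu>. rev (sorted_list_of_set (left_key_column \<mu> T c)) ! r)"


subsection \<open>Order on compositions\<close>

text \<open>Column \<open>j \<ge> 1\<close> of \<open>key(\<alpha>)\<close>, as a set; here \<open>j\<close> is the actual column number.\<close>

definition key_column :: "composition \<Rightarrow> nat \<Rightarrow> nat set" where
  "key_column \<alpha> j = {i. j \<le> Poly_Mapping.lookup \<alpha> i}"

definition key_le :: "composition \<Rightarrow> composition \<Rightarrow> bool" where
  "key_le \<alpha> \<gamma> \<longleftrightarrow> sort_comp \<alpha> = sort_comp \<gamma> \<and>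
     (\<forall>j\<ge>1. \<forall>r<card (key_column \<alpha> j).
        sorted_list_of_set (key_column \<alpha> j) ! r \<le> sorted_list_of_set (key_column \<gamma> j) ! r)"

end

theory Submission
  imports Defs
begin

text \<open>
  The tableau sum is computed column by column.  If the columns \<open>C\<close> and \<open>D\<close> are adjacent, the
  factors \<open>1 + \<beta> x\<^sub>k\<close> coming from \<open>C\<close> are those with \<open>k \<notin> C\<close> such that fewer elements of \<open>D\<close> than of
  \<open>C\<close> exceed \<open>k\<close>.  The operation \<open>C \<triangleleft> _\<close> has an adjoint: \<open>C \<triangleleft> A \<le> E\<close> iff \<open>A \<le> cap C E\<close>, where
  \<open>cap C E\<close> is the largest \<open>card E\<close>-element subset of \<open>C\<close> below \<open>E\<close>.  Hence \<open>K\<^sub>-(T) \<le> \<alpha>\<close> means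
  that the first column \<open>C\<close> of \<open>T\<close> is below the first column of \<open>key(\<alpha>)\<close> and that the remaining
  columns satisfy the same condition for the columns \<open>cap C E\<^sub>2, cap C E\<^sub>3, \<dots>\<close>, which gives a
  recursion \<open>Phi C Es\<close> in the list \<open>Es\<close> of bounding columns.

  Applying \<open>s\<^sub>i\<close> to a bounding key with \<open>\<alpha>\<^sub>i \<ge> \<alpha>\<^bsub>i+1\<^esub>\<close> has one of three effects, depending on the preceding
  column \<open>C\<close>: it applies \<open>\<pi>\<^sub>i\<close> if \<open>i, i+1 \<in> C\<close>; it does nothing and the sum is symmetric if
  \<open>i, i+1 \<notin> C\<close>; and it applies \<open>f \<mapsto> (1 + \<beta> x\<^sub>i) \<partial>\<^sub>i(x\<^sub>i f)\<close> if \<open>i \<in> C\<close>, \<open>i+1 \<notin> C\<close> and \<open>C\<close> is swapped as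
  well.  These three statements are proved together by induction on the number of columns.  The
  first one, for \<open>C\<close> a long initial interval, which contributes no factors, is the recursion of the
  Lascoux polynomials.  So the tableau sums themselves are a solution of the system that defines
  the Lascoux polynomials; it is unique because \<open>\<Sum>\<^sub>j j \<alpha>\<^sub>j\<close> decreases along the recursion.
\<close>

subsection \<open>Divided differences\<close>

lemma swap_comp_involutive [simp]: "swap_comp i (swap_comp i \<alpha>) = \<alpha>"
  by (intro poly_mapping_eqI) (simp add: lookup_swap_comp)

lemma swap_comp_add: "swap_comp i (\<alpha> + \<gamma>) = swap_comp i \<alpha> + swap_comp i \<gamma>"
  by (intro poly_mapping_eqI) (simp add: lookup_swap_comp lookup_add)

lemma swap_comp_single:
  "swap_comp i (Poly_Mapping.single j c) = Poly_Mapping.single (transpose i (Suc i) j) c"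
  by (intro poly_mapping_eqI)
    (auto simp: lookup_swap_comp lookup_single when_def transpose_eq_iff)

text \<open>A finitely supported function is a finite sum of singletons, and zero is the singleton
  with value 0. Additive statements about polynomials thus reduce to monomials.\<close>

lemma poly_mapping_single_induct [case_names single add]:
  assumes "\<And>a b. P (Poly_Mapping.single a b)" "\<And>f g. P f \<Longrightarrow> P g \<Longrightarrow> P (f + g)"
  shows "P f"
proof (induction f rule: Poly_Mapping.update_induct)
  case const
  show ?case using assms(1)[of _ 0] by simp
next
  case (update f a b)
  have "Poly_Mapping.update a b f = f + Poly_Mapping.single a b"
    using update(1) by (intro poly_mapping_eqI)
      (auto simp: lookup_update lookup_add lookup_single when_def in_keys_iff)
  then show ?case using assms update(3) by metis
qed

lemma swap_vars_single:
  "swap_vars i (Poly_Mapping.single \<alpha> c) = Poly_Mapping.single (swap_comp i \<alpha>) c"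
  by (intro poly_mapping_eqI)
    (auto simp: lookup_swap_vars lookup_single when_def)

lemma swap_vars_zero [simp]: "swap_vars i 0 = 0"
  by (intro poly_mapping_eqI) (simp add: lookup_swap_vars)

lemma swap_vars_add: "swap_vars i (f + g) = swap_vars i f + swap_vars i g"
  by (intro poly_mapping_eqI) (simp add: lookup_swap_vars lookup_add)

lemma swap_vars_diff: "swap_vars i (f - g) = swap_vars i f - swap_vars i g"
  by (intro poly_mapping_eqI) (simp add: lookup_swap_vars lookup_minus)

lemma swap_vars_involutive [simp]: "swap_vars i (swap_vars i f) = f"
  by (intro poly_mapping_eqI) (simp add: lookup_swap_vars)

lemma swap_vars_mult: "swap_vars i (f * g) = swap_vars i f * swap_vars i g"
proof (induction f rule: poly_mapping_single_induct)
  case (single a b)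
  show ?case
    by (induction g rule: poly_mapping_single_induct)
      (simp_all add: mult_single swap_vars_single swap_comp_add algebra_simps swap_vars_add)
next
  case (add f g)
  then show ?case by (simp add: swap_vars_add algebra_simps)
qed

lemma swap_comp_zero [simp]: "swap_comp i 0 = 0"
  by (intro poly_mapping_eqI) (simp add: lookup_swap_comp)

lemma swap_vars_one [simp]: "swap_vars i 1 = 1"
  by (simp add: swap_vars_single flip: single_one)

lemma swap_vars_beta [simp]: "swap_vars i beta = beta"
  by (simp add: beta_def swap_vars_single)

lemma swap_vars_var: "swap_vars i (var j) = var (transpose i (Suc i) j)"
  by (simp add: var_def monomial_def swap_vars_single swap_comp_single)

lemma swap_vars_prod: "swap_vars i (prod f A) = (\<Prod>a\<in>A. swap_vars i (f a))"
  by (induction A rule: infinite_finite_induct) (simp_all add: swap_vars_mult)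

lemma swap_vars_sum: "swap_vars i (sum f A) = (\<Sum>a\<in>A. swap_vars i (f a))"
  by (induction A rule: infinite_finite_induct) (simp_all add: swap_vars_add)

lemma var_neq: "i \<noteq> j \<Longrightarrow> var i \<noteq> var j"
proof
  assume "i \<noteq> j" "var i = var j"
  then have "Poly_Mapping.lookup (var i) (Poly_Mapping.single i 1) =
    Poly_Mapping.lookup (var j) (Poly_Mapping.single i 1)" by simp
  moreover have "Poly_Mapping.single i (1::nat) \<noteq> Poly_Mapping.single j 1"
    using \<open>i \<noteq> j\<close> by (metis lookup_single_eq lookup_single_not_eq one_neq_zero)
  ultimately show False
    by (simp add: var_def monomial_def lookup_single when_def)
qed

lemma monomial_zero [simp]: "monomial 0 = 1"
  by (simp add: monomial_def)

lemma monomial_add: "monomial (\<alpha> + \<gamma>) = monomial \<alpha> * monomial \<gamma>"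
  by (simp add: monomial_def mult_single)

lemma monomial_sum: "monomial (sum f A) = (\<Prod>a\<in>A. monomial (f a))"
  by (induction A rule: infinite_finite_induct) (simp_all add: monomial_add)

text \<open>With s for the swap, fg - s(fg) = (f - s f) g + s f (g - s g), so divisibility passes to
  products and only has to be seen for a single variable.\<close>

lemma monomial_dvd_diff: "var i - var (Suc i) dvd monomial \<alpha> - monomial (swap_comp i \<alpha>)"
proof (induction \<alpha> rule: poly_mapping_single_induct)
  case (single j n)
  show ?case
  proof (induction n)
    case 0
    show ?case by simp
  next
    case (Suc n)
    let ?d = "var i - var (Suc i)"
    have eq: "Poly_Mapping.single j (Suc n) = Poly_Mapping.single j 1 + Poly_Mapping.single j n"
      by (simp flip: single_add)
    have "?d dvd var j - var (transpose i (Suc i) j)"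
      by (metis (no_types) cancel_comm_monoid_add_class.diff_cancel dvd_0_right dvd_minus_iff dvd_refl
          minus_diff_eq transpose_apply_first transpose_apply_other transpose_apply_second)
    then have "?d dvd (var j - var (transpose i (Suc i) j)) * monomial (Poly_Mapping.single j n)
      + var (transpose i (Suc i) j) *
        (monomial (Poly_Mapping.single j n) - monomial (swap_comp i (Poly_Mapping.single j n)))"
      using Suc by (intro dvd_add) (auto intro: dvd_mult dvd_mult2)
    then show ?case
      by (simp add: eq monomial_add swap_comp_add swap_comp_single var_def algebra_simps)
  qed
next
  case (add f g)
  have "monomial (f + g) - monomial (swap_comp i (f + g)) =
    (monomial f - monomial (swap_comp i f)) * monomial g +
    monomial (swap_comp i f) * (monomial g - monomial (swap_comp i g))"
    by (simp add: monomial_add swap_comp_add algebra_simps)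
  with add show ?case by (auto intro!: dvd_add dvd_mult dvd_mult2)
qed

lemma divided_diff_dvd: "var i - var (Suc i) dvd f - swap_vars i f"
proof (induction f rule: poly_mapping_single_induct)
  case (single a b)
  have eq: "Poly_Mapping.single a b = Poly_Mapping.single 0 b * monomial a" for a
    by (simp add: monomial_def mult_single)
  have "Poly_Mapping.single a b - swap_vars i (Poly_Mapping.single a b) =
    Poly_Mapping.single 0 b * (monomial a - monomial (swap_comp i a))"
    by (simp add: swap_vars_single eq[symmetric] right_diff_distrib)
  then show ?case using monomial_dvd_diff by simp
next
  case (add f g)
  have "f + g - swap_vars i (f + g) = (f - swap_vars i f) + (g - swap_vars i g)"
    by (simp add: swap_vars_add)
  with add show ?case by (metis dvd_add)
qed

text \<open>The definite description is meaningful: the quotient exists by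
  \<open>divided_diff_dvd\<close>, and it is unique because \<open>var i - var (Suc i)\<close> is
  nonzero in an integral domain.\<close>

lemma divided_diff_mult: "divided_diff i f * (var i - var (Suc i)) = f - swap_vars i f"
proof -
  obtain g where g: "g * (var i - var (Suc i)) = f - swap_vars i f"
    using divided_diff_dvd[of i f] by (metis dvd_def mult.commute)
  have "\<exists>!g. g * (var i - var (Suc i)) = f - swap_vars i f"
    using g var_neq[of i "Suc i"] by (intro ex1I[of _ g]) (auto simp flip: g)
  from theI'[OF this] show ?thesis unfolding divided_diff_def .
qed

lemma divided_diff_eqI: "g * (var i - var (Suc i)) = f - swap_vars i f \<Longrightarrow> divided_diff i f = g"
  using divided_diff_mult[of i f] var_neq[of i "Suc i"]
  by (metis mult_right_cancel n_not_Suc_n right_minus_eq)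

lemma divided_diff_add: "divided_diff i (f + g) = divided_diff i f + divided_diff i g"
  by (intro divided_diff_eqI) (simp add: distrib_right divided_diff_mult swap_vars_add)

lemma divided_diff_zero [simp]: "divided_diff i 0 = 0"
  by (intro divided_diff_eqI) simp

lemma divided_diff_symmetric: "swap_vars i f = f \<Longrightarrow> divided_diff i f = 0"
  by (intro divided_diff_eqI) simp

text \<open>This is the twisted Leibniz rule; it comes from writing fg - s(fg) as (f - s f) g + s f
  (g - s g).\<close>

lemma divided_diff_product:
  "divided_diff i (f * g) = divided_diff i f * g + swap_vars i f * divided_diff i g"
proof (intro divided_diff_eqI)
  have "(divided_diff i f * g + swap_vars i f * divided_diff i g) * (var i - var (Suc i)) =
    (divided_diff i f * (var i - var (Suc i))) * g +
    swap_vars i f * (divided_diff i g * (var i - var (Suc i)))"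
    by (simp only: distrib_left distrib_right mult_ac)
  also have "\<dots> = f * g - swap_vars i (f * g)"
    by (simp only: divided_diff_mult) (simp add: swap_vars_mult algebra_simps)
  finally show "(divided_diff i f * g + swap_vars i f * divided_diff i g) *
    (var i - var (Suc i)) = f * g - swap_vars i (f * g)" .
qed

text \<open>The swap changes the sign of both the numerator and the denominator of the
  quotient.\<close>

lemma swap_vars_divided_diff [simp]: "swap_vars i (divided_diff i f) = divided_diff i f"
proof (rule divided_diff_eqI[symmetric])
  have "swap_vars i (divided_diff i f * (var i - var (Suc i))) = swap_vars i f - f"
    by (simp add: divided_diff_mult swap_vars_diff)
  then have "swap_vars i (divided_diff i f) * (var (Suc i) - var i) = swap_vars i f - f"
    by (simp add: swap_vars_mult swap_vars_diff swap_vars_var)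
  then show "swap_vars i (divided_diff i f) * (var i - var (Suc i)) = f - swap_vars i f"
    by (simp add: algebra_simps)
qed

lemma divided_diff_var [simp]:
  "divided_diff i (var i) = 1" "divided_diff i (var (Suc i)) = - 1"
  by (auto intro!: divided_diff_eqI simp: swap_vars_var)

lemma divided_diff_const_mult:
  "swap_vars i c = c \<Longrightarrow> divided_diff i (c * f) = c * divided_diff i f"
  by (simp add: divided_diff_product divided_diff_symmetric)

section \<open>The Demazure-Lascoux operator\<close>

lemma demazure_lascoux_add:
  "demazure_lascoux i (f + g) = demazure_lascoux i f + demazure_lascoux i g"
  by (simp add: demazure_lascoux_def distrib_left divided_diff_add)

lemma demazure_lascoux_const_mult:
  "swap_vars i c = c \<Longrightarrow> demazure_lascoux i (c * f) = c * demazure_lascoux i f"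
  using divided_diff_const_mult[of i c "(1 + beta * var (Suc i)) * var i * f"]
  by (simp add: demazure_lascoux_def mult_ac)

lemma swap_vars_demazure_lascoux [simp]:
  "swap_vars i (demazure_lascoux i f) = demazure_lascoux i f"
  by (simp add: demazure_lascoux_def)

lemma divided_diff_weight: "divided_diff i ((1 + beta * var (Suc i)) * var i) = 1"
  by (intro divided_diff_eqI)
    (simp add: swap_vars_mult swap_vars_add swap_vars_var algebra_simps)

lemma swap_vars_weight:
  "swap_vars i ((1 + beta * var (Suc i)) * var i) = (1 + beta * var i) * var (Suc i)"
  by (simp add: swap_vars_mult swap_vars_add swap_vars_var)

text \<open>The Leibniz rule is applied to the weight
  \<open>(1 + beta * var (Suc i)) * var i\<close>, whose divided difference is 1. In particular
  symmetric polynomials are fixed by the operator.\<close>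

lemma demazure_lascoux_eq:
  "demazure_lascoux i f = f + (1 + beta * var i) * var (Suc i) * divided_diff i f"
  unfolding demazure_lascoux_def
  by (simp only: divided_diff_product[of i "(1 + beta * var (Suc i)) * var i"]
      divided_diff_weight swap_vars_weight mult_1_left)

lemma demazure_lascoux_symmetric: "swap_vars i f = f \<Longrightarrow> demazure_lascoux i f = f"
  by (simp add: demazure_lascoux_eq divided_diff_symmetric)

subsection \<open>Dominance of finite sets\<close>

definition cnt :: "nat set \<Rightarrow> nat \<Rightarrow> nat" where
  "cnt A k = card {x \<in> A. k \<le> x}"

text \<open>For finite sets this is the entrywise comparison of the sorted elements, see
  \<open>dom_le_iff_nth\<close>. The counting form suits scanning arguments, since each position
  changes a count by at most one.\<close>

definition dom_le :: "nat set \<Rightarrow> nat set \<Rightarrow> bool" where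
  "dom_le A E \<longleftrightarrow> finite A \<and> card A = card E \<and> (\<forall>k. cnt A k \<le> cnt E k)"

lemma cnt_0 [simp]: "cnt A 0 = card A"
  by (simp add: cnt_def)

lemma cnt_step: "finite A \<Longrightarrow> cnt A k = cnt A (Suc k) + of_bool (k \<in> A)"
proof -
  assume "finite A"
  have "{x \<in> A. k \<le> x} = (if k \<in> A then insert k {x \<in> A. Suc k \<le> x} else {x \<in> A. Suc k \<le> x})"
    by (auto simp: Suc_le_eq le_less)
  with \<open>finite A\<close> show ?thesis by (simp add: cnt_def)
qed

lemma cnt_mono: "finite B \<Longrightarrow> A \<subseteq> B \<Longrightarrow> cnt A k \<le> cnt B k"
  unfolding cnt_def by (intro card_mono) auto

lemma cnt_le_card: "finite A \<Longrightarrow> cnt A k \<le> card A"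
  unfolding cnt_def by (intro card_mono) auto

lemma cnt_eq_0: "(\<And>x. x \<in> A \<Longrightarrow> x < k) \<Longrightarrow> cnt A k = 0"
  unfolding cnt_def by (metis (mono_tags, lifting) card.empty empty_Collect_eq not_le)

lemma cnt_pos: "finite A \<Longrightarrow> x \<in> A \<Longrightarrow> k \<le> x \<Longrightarrow> 0 < cnt A k"
  unfolding cnt_def by (subst card_gt_0_iff) auto

lemma finite_bounded:
  assumes "finite (A :: nat set)" "finite B"
  obtains N where "\<And>x. x \<in> A \<Longrightarrow> x < N" "\<And>x. x \<in> B \<Longrightarrow> x < N"
  using assms finite_nat_set_iff_bounded[of "A \<union> B"] by (metis UnCI finite_UnI)

text \<open>Membership of \<open>k\<close> is the difference of the counts at \<open>k\<close> and
  \<open>Suc k\<close>.\<close>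

lemma cnt_inject:
  assumes "finite A" "finite B" "\<And>k. cnt A k = cnt B k"
  shows "A = B"
proof -
  have "of_bool (k \<in> A) = (of_bool (k \<in> B) :: nat)" for k
    using cnt_step[OF assms(1), of k] cnt_step[OF assms(2), of k] assms(3)[of k] assms(3)[of "Suc k"]
    by linarith
  then show ?thesis by (auto simp: of_bool_eq_iff)
qed

lemma dom_le_antisym: "dom_le A B \<Longrightarrow> dom_le B A \<Longrightarrow> A = B"
  unfolding dom_le_def by (intro cnt_inject) (auto simp: order_antisym)

lemma dom_le_trans: "dom_le A B \<Longrightarrow> dom_le B C \<Longrightarrow> dom_le A C"
  unfolding dom_le_def by (auto intro: order_trans)

lemma dom_le_refl: "finite A \<Longrightarrow> dom_le A A"
  by (simp add: dom_le_def)

lemma dom_leD: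
  assumes "dom_le A E"
  shows "finite A" "card A = card E" "cnt A k \<le> cnt E k"
  using assms by (auto simp: dom_le_def)

lemma dom_le_bounded:
  assumes "dom_le A E" "finite E" "\<And>x. x \<in> E \<Longrightarrow> x < N" "x \<in> A"
  shows "x < N"
proof (rule ccontr)
  assume "\<not> x < N"
  then have "0 < cnt A N" using assms(4) dom_leD(1)[OF assms(1)] by (intro cnt_pos) auto
  moreover have "cnt E N = 0" using assms(3) by (rule cnt_eq_0)
  ultimately show False using dom_leD(3)[OF assms(1), of N] by simp
qed

lemma finite_dom_le: "finite E \<Longrightarrow> finite {A. dom_le A E}"
proof -
  assume "finite E"
  then obtain N where "\<And>x. x \<in> E \<Longrightarrow> x < N" using finite_bounded[of E E] by auto
  then have "{A. dom_le A E} \<subseteq> Pow {..<N}"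
    using \<open>finite E\<close> by (auto intro: dom_le_bounded[of _ E])
  then show ?thesis by (rule finite_subset) simp
qed

lemma card_below: "finite A \<Longrightarrow> card {x \<in> A. x < k} + cnt A k = card A"
proof -
  assume "finite A"
  have "{x \<in> A. x < k} \<union> {x \<in> A. k \<le> x} = A" by auto
  moreover have "card ({x \<in> A. x < k} \<union> {x \<in> A. k \<le> x}) =
      card {x \<in> A. x < k} + card {x \<in> A. k \<le> x}"
    using \<open>finite A\<close> by (intro card_Un_disjoint) auto
  ultimately show ?thesis by (simp add: cnt_def)
qed

text \<open>
  Scanning downwards, each element of \<open>E\<close> joins a queue and each element of \<open>D\<close> serves one waiting
  element, if there is any; \<open>dn_queue D E k\<close> is the length of the queue after position \<open>k\<close>, and
  \<open>cap D E\<close> consists of the elements of \<open>D\<close> that serve.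
\<close>

definition dn_queue :: "nat set \<Rightarrow> nat set \<Rightarrow> nat \<Rightarrow> nat" where
  "dn_queue D E k =
     foldr (\<lambda>j q. q + of_bool (j \<in> E) - of_bool (j \<in> D)) [k..<Suc (Max (insert 0 E))] 0"

definition cap :: "nat set \<Rightarrow> nat set \<Rightarrow> nat set" where
  "cap D E = {k \<in> D. k \<in> E \<or> 0 < dn_queue D E (Suc k)}"

lemma dn_queue_above: "finite E \<Longrightarrow> (\<And>x. x \<in> E \<Longrightarrow> x < k) \<Longrightarrow> dn_queue D E k = 0"
proof (cases "k = 0")
  case True
  assume "\<And>x. x \<in> E \<Longrightarrow> x < k"
  with True have "E = {}" by auto
  with True show ?thesis by (simp add: dn_queue_def)
next
  case False
  assume "finite E" "\<And>x. x \<in> E \<Longrightarrow> x < k"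
  with False have "Suc (Max (insert 0 E)) \<le> k" by (auto simp: Suc_le_eq)
  then show ?thesis by (simp add: dn_queue_def del: upt_Suc)
qed

text \<open>Truncated subtraction models an element of \<open>D\<close> that finds the queue empty.
  Above the maximum of \<open>E\<close> the fold runs over an empty list, and the recursion persists
  because nothing arrives there.\<close>

lemma dn_queue_step:
  assumes "finite E"
  shows "dn_queue D E k = dn_queue D E (Suc k) + of_bool (k \<in> E) - of_bool (k \<in> D)"
proof (cases "k < Suc (Max (insert 0 E))")
  case True
  then show ?thesis by (simp add: dn_queue_def upt_conv_Cons del: upt_Suc)
next
  case False
  have lt: "x < k" if "x \<in> E" for x
  proof -
    have "x \<le> Max (insert 0 E)" using assms that by (intro Max_ge) auto
    with False show ?thesis by linarith
  qed
  have "dn_queue D E k = 0" by (rule dn_queue_above[OF assms lt])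
  moreover have "dn_queue D E (Suc k) = 0"
    by (rule dn_queue_above[OF assms]) (use lt in \<open>simp add: less_SucI\<close>)
  moreover have "k \<notin> E" using lt by blast
  ultimately show ?thesis by simp
qed

text \<open>Induction along a downward scan: positions from \<open>N\<close> on are settled
  outright, the others follow from their upper neighbour.\<close>

lemma down_induct [case_names above step]:
  assumes "\<And>k. N \<le> k \<Longrightarrow> P k" "\<And>k. P (Suc k) \<Longrightarrow> P k"
  shows "P (k :: nat)"
proof (cases "N \<le> k")
  case False
  then have "k \<le> N" by simp
  then show ?thesis by (induction rule: inc_induct) (use assms in auto)
qed (use assms in auto)

lemma cap_subset: "cap D E \<subseteq> D"
  by (auto simp: cap_def)

lemma finite_cap: "finite D \<Longrightarrow> finite (cap D E)"
  using cap_subset finite_subset by blast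

text \<open>Conservation law of the queue: an element of \<open>E\<close> at or above
  \<open>k\<close> has either been served, which accounts for one element of \<open>cap D E\<close>,
  or is still waiting.\<close>

lemma cnt_cap:
  assumes "finite D" "finite E"
  shows "cnt (cap D E) k + dn_queue D E k = cnt E k"
proof -
  obtain N where N: "\<And>x. x \<in> D \<Longrightarrow> x < N" "\<And>x. x \<in> E \<Longrightarrow> x < N"
    using finite_bounded[OF assms(1,2)] by metis
  show ?thesis
  proof (induction k rule: down_induct[where N = N])
    case (above k)
    have "cnt E k = 0" by (rule cnt_eq_0) (use N(2) above in \<open>fastforce\<close>)
    moreover have "cnt (cap D E) k = 0"
      by (rule cnt_eq_0) (use N(1) above cap_subset in \<open>fastforce\<close>)
    moreover have "dn_queue D E k = 0"
      by (rule dn_queue_above[OF assms(2)]) (use N(2) above in \<open>fastforce\<close>)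
    ultimately show ?case by simp
  next
    case (step k)
    then show ?case
      using cnt_step[OF finite_cap[OF assms(1)], of E k] cnt_step[OF assms(2), of k]
        dn_queue_step[OF assms(2), of D k]
      by (auto simp: cap_def of_bool_def split: if_splits)
  qed
qed

text \<open>Greedy optimality. The only critical positions \<open>k\<close> are those in
  \<open>B\<close> but not in \<open>cap D E\<close>. Such a \<open>k\<close> idles, so the queue is
  empty there, and by \<open>cnt_cap\<close> the count of \<open>cap D E\<close> at \<open>k\<close>
  equals that of \<open>E\<close>, which bounds that of \<open>B\<close>.\<close>

lemma cap_maximal:
  assumes "finite D" "finite E" "B \<subseteq> D" "\<And>k. cnt B k \<le> cnt E k"
  shows "cnt B k \<le> cnt (cap D E) k"
proof -
  obtain N where N: "\<And>x. x \<in> D \<Longrightarrow> x < N" "\<And>x. x \<in> E \<Longrightarrow> x < N"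
    using finite_bounded[OF assms(1,2)] by metis
  have finB: "finite B" using assms finite_subset by blast
  show ?thesis
  proof (induction k rule: down_induct[where N = N])
    case (above k)
    have "cnt B k = 0" by (rule cnt_eq_0) (use N(1) above assms(3) in \<open>fastforce\<close>)
    then show ?case by simp
  next
    case (step k)
    then show ?case
      using cnt_step[OF finite_cap[OF assms(1)], of E k] cnt_step[OF assms(2), of k]
        dn_queue_step[OF assms(2), of D k] cnt_step[OF finB, of k] assms(3) assms(4)[of k]
        cnt_cap[OF assms(1,2), of k] cnt_cap[OF assms(1,2), of "Suc k"]
      by (cases "k \<in> B"; cases "k \<in> D"; cases "k \<in> E"; cases "dn_queue D E (Suc k) = 0")
        (auto simp: cap_def subset_iff)
  qed
qed

text \<open>The last assumption is a Hall condition for serving each element of \<open>E\<close> by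
  an element of \<open>D\<close> at or below it. It forces the queue to be empty at the end of the
  scan, so that \<open>cap D E\<close> has full size.\<close>

lemma cap_dom_le:
  assumes "finite D" "finite E" "\<And>k. card {x \<in> E. x < k} \<le> card {x \<in> D. x < k}"
  shows "dom_le (cap D E) E"
proof -
  obtain N where N: "\<And>x. x \<in> D \<Longrightarrow> x < N" "\<And>x. x \<in> E \<Longrightarrow> x < N"
    using finite_bounded[OF assms(1,2)] by metis
  have "dn_queue D E 0 = 0"
  proof (rule ccontr)
    assume pos: "dn_queue D E 0 \<noteq> 0"
    \<comment> \<open>If the final queue is nonempty, the Hall condition keeps it nonempty at every
      position, so no subtraction truncates and arrivals and services balance exactly. At
      \<open>N\<close>, where the queue is empty, this is contradictory.\<close>
    have "dn_queue D E 0 + card {x \<in> D. x < k} \<le> dn_queue D E k + card {x \<in> E. x < k}" for k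
    proof (induction k)
      case 0
      then show ?case by simp
    next
      case (Suc k)
      have s: "card {x \<in> A. x < Suc k} = card {x \<in> A. x < k} + of_bool (k \<in> A)"
        if "finite A" for A
        using card_below[OF that, of k] card_below[OF that, of "Suc k"] cnt_step[OF that, of k]
        by linarith
      from Suc pos assms(3)[of k] have "0 < dn_queue D E k" by linarith
      then show ?case
        using Suc s[OF assms(1)] s[OF assms(2)] dn_queue_step[OF assms(2), of D k] by linarith
    qed
    from this[of N] have "dn_queue D E 0 + card {x \<in> D. x < N} \<le>
      dn_queue D E N + card {x \<in> E. x < N}" .
    moreover have "dn_queue D E N = 0" using N by (intro dn_queue_above assms)
    ultimately have "dn_queue D E 0 + card {x \<in> D. x < N} \<le> card {x \<in> E. x < N}"
      by simp
    with assms(3)[of N] pos show False by linarith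
  qed
  then show ?thesis
    using cnt_cap[OF assms(1,2)] finite_cap[OF assms(1)] unfolding dom_le_def
    by (metis add.right_neutral cnt_0 le_add1)
qed

lemma cap_dom_le':
  assumes "dom_le D F" "finite F" "E \<subseteq> F"
  shows "dom_le (cap D E) E"
proof -
  have fin: "finite D" "finite E" using assms finite_subset by (auto simp: dom_le_def)
  have "card {x \<in> E. x < k} \<le> card {x \<in> D. x < k}" for k
  proof -
    have "card {x \<in> E. x < k} \<le> card {x \<in> F. x < k}"
      using assms by (intro card_mono) auto
    moreover have "card {x \<in> F. x < k} \<le> card {x \<in> D. x < k}"
      using card_below[OF fin(1), of k] card_below[OF assms(2), of k] dom_leD(2)[OF assms(1)]
        dom_leD(3)[OF assms(1), of k] by linarith
    ultimately show ?thesis by simp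
  qed
  with fin show ?thesis by (intro cap_dom_le)
qed

text \<open>More arrivals make the queue at least as long at every position.\<close>

lemma cap_mono:
  assumes "finite E" "F \<subseteq> E"
  shows "cap D F \<subseteq> cap D E"
proof -
  obtain N where N: "\<And>x. x \<in> E \<Longrightarrow> x < N"
    using finite_bounded[OF assms(1) assms(1)] by blast
  have finF: "finite F" using assms finite_subset by blast
  have le: "dn_queue D F k \<le> dn_queue D E k" for k
  proof (induction k rule: down_induct[where N = N])
    case (above k)
    have "dn_queue D F k = 0"
      by (rule dn_queue_above[OF finF]) (use N above assms(2) in \<open>fastforce\<close>)
    then show ?case by simp
  next
    case (step k)
    have "of_bool (k \<in> F) \<le> (of_bool (k \<in> E) :: nat)" using assms(2) by auto
    with step show ?case
      using dn_queue_step[OF assms(1), of D k] dn_queue_step[OF finF, of D k] by linarith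
  qed
  show ?thesis
  proof
    fix x assume "x \<in> cap D F"
    then show "x \<in> cap D E" using le[of "Suc x"] assms(2) by (auto simp: cap_def)
  qed
qed

lemma dn_queue_cong_above:
  assumes "finite E" "finite E'" "\<And>k. l \<le> k \<Longrightarrow> (k \<in> E \<longleftrightarrow> k \<in> E') \<and> (k \<in> D \<longleftrightarrow> k \<in> D')" "l \<le> k"
  shows "dn_queue D E k = dn_queue D' E' k"
proof -
  obtain N where N: "\<And>x. x \<in> E \<Longrightarrow> x < N" "\<And>x. x \<in> E' \<Longrightarrow> x < N"
    using finite_bounded[OF assms(1,2)] by metis
  have "l \<le> k \<longrightarrow> ?thesis"
  proof (induction k rule: down_induct[where N = N])
    case (above k)
    have "dn_queue D E k = 0" "dn_queue D' E' k = 0"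
      by (rule dn_queue_above, rule assms, erule less_le_trans[OF N(1) above])
        (rule dn_queue_above, rule assms, erule less_le_trans[OF N(2) above])
    then show ?case by simp
  next
    case (step k)
    then show ?case
      using dn_queue_step[OF assms(1), of D k] dn_queue_step[OF assms(2), of D' k] assms(3)[of k]
      by auto
  qed
  with assms(4) show ?thesis by simp
qed

lemma dn_queue_cong_below:
  assumes "finite E" "finite E'" "\<And>k. k < l \<Longrightarrow> (k \<in> E \<longleftrightarrow> k \<in> E') \<and> (k \<in> D \<longleftrightarrow> k \<in> D')"
    "dn_queue D E l = dn_queue D' E' l" "k \<le> l"
  shows "dn_queue D E k = dn_queue D' E' k"
  using assms(5)
proof (induction rule: inc_induct)
  case (step k)
  then show ?case
    using dn_queue_step[OF assms(1), of D k] dn_queue_step[OF assms(2), of D' k] assms(3)[of k]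
    by simp
qed (rule assms)

section \<open>Transposing adjacent letters in sets and in the greedy matching\<close>

definition sw :: "nat \<Rightarrow> nat set \<Rightarrow> nat set" where
  "sw i A = transpose i (Suc i) ` A"

lemma mem_sw: "x \<in> sw i A \<longleftrightarrow> transpose i (Suc i) x \<in> A"
  unfolding sw_def by (metis image_iff transpose_involutory)

lemma finite_sw [simp]: "finite (sw i A) \<longleftrightarrow> finite A"
  by (simp add: sw_def finite_image_iff)

lemma mem_sw_simps [simp]:
  "i \<in> sw i A \<longleftrightarrow> Suc i \<in> A" "Suc i \<in> sw i A \<longleftrightarrow> i \<in> A"
  "x < i \<Longrightarrow> x \<in> sw i A \<longleftrightarrow> x \<in> A" "Suc i < x \<Longrightarrow> x \<in> sw i A \<longleftrightarrow> x \<in> A"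
  by (auto simp: mem_sw transpose_def)

lemma sw_involutive [simp]: "sw i (sw i A) = A"
  by (simp add: sw_def image_image)

lemma card_sw [simp]: "card (sw i A) = card A"
  unfolding sw_def by (intro card_image) simp

lemma sw_subset_iff [simp]: "sw i A \<subseteq> sw i B \<longleftrightarrow> A \<subseteq> B"
  by (metis image_mono sw_def sw_involutive)

lemma set_eq_at:
  assumes "\<And>x. x < i \<Longrightarrow> x \<in> A \<longleftrightarrow> x \<in> B" "\<And>x. Suc i < x \<Longrightarrow> x \<in> A \<longleftrightarrow> x \<in> B"
    "i \<in> A \<longleftrightarrow> i \<in> B" "Suc i \<in> A \<longleftrightarrow> Suc i \<in> B"
  shows "A = B"
proof (rule set_eqI)
  fix x
  consider "x < i" | "x = i" | "x = Suc i" | "Suc i < x" by linarith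
  then show "x \<in> A \<longleftrightarrow> x \<in> B" using assms by cases auto
qed

lemma sw_eq_self: "(i \<in> A \<longleftrightarrow> Suc i \<in> A) \<Longrightarrow> sw i A = A"
  by (rule set_eq_at[of i]) auto

text \<open>The threshold \<open>Suc i\<close> is the only one that separates \<open>i\<close> from
  \<open>Suc i\<close>.\<close>

lemma cnt_sw:
  assumes "k \<noteq> Suc i"
  shows "cnt (sw i A) k = cnt A k"
proof -
  have "{x \<in> sw i A. k \<le> x} = transpose i (Suc i) ` {x \<in> A. k \<le> x}"
    using assms by (auto simp: sw_def transpose_def split: if_splits)
  moreover have "inj_on (transpose i (Suc i)) {x \<in> A. k \<le> x}"
    using inj_on_subset by fastforce
  ultimately show ?thesis by (simp add: cnt_def card_image)
qed

text \<open>The scan runs downwards, so a change at \<open>i\<close> and \<open>Suc i\<close> has no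
  effect above them, and below \<open>i\<close> the past enters only through the queue length at
  \<open>i\<close>. What remains to be examined are the two positions themselves.\<close>

lemma cap_local:
  assumes "finite E" "finite E'" "\<And>k. k < i \<or> Suc i < k \<Longrightarrow> (k \<in> E \<longleftrightarrow> k \<in> E') \<and> (k \<in> D \<longleftrightarrow> k \<in> D')"
  shows "\<And>k. Suc i < k \<Longrightarrow> k \<in> cap D E \<longleftrightarrow> k \<in> cap D' E'"
    "dn_queue D E (Suc (Suc i)) = dn_queue D' E' (Suc (Suc i))"
    "\<And>k. dn_queue D E i = dn_queue D' E' i \<Longrightarrow> k < i \<Longrightarrow> k \<in> cap D E \<longleftrightarrow> k \<in> cap D' E'"
proof -
  have eq: "(k \<in> E \<longleftrightarrow> k \<in> E') \<and> (k \<in> D \<longleftrightarrow> k \<in> D')" if "Suc (Suc i) \<le> k" for k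
    using that by (intro assms(3)) linarith
  have a: "dn_queue D E k = dn_queue D' E' k" if "Suc (Suc i) \<le> k" for k
    by (rule dn_queue_cong_above[OF assms(1,2) _ that]) (rule eq)
  show "dn_queue D E (Suc (Suc i)) = dn_queue D' E' (Suc (Suc i))" by (rule a) simp
  show "k \<in> cap D E \<longleftrightarrow> k \<in> cap D' E'" if "Suc i < k" for k
  proof -
    have "dn_queue D E (Suc k) = dn_queue D' E' (Suc k)" by (rule a) (use that in simp)
    moreover have "(k \<in> E \<longleftrightarrow> k \<in> E') \<and> (k \<in> D \<longleftrightarrow> k \<in> D')" using that by (intro eq) simp
    ultimately show ?thesis unfolding cap_def by simp
  qed
  have eq': "(k \<in> E \<longleftrightarrow> k \<in> E') \<and> (k \<in> D \<longleftrightarrow> k \<in> D')" if "k < i" for k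
    using that by (intro assms(3)) simp
  fix k
  assume i: "dn_queue D E i = dn_queue D' E' i" "k < i"
  have "dn_queue D E (Suc k) = dn_queue D' E' (Suc k)"
    by (rule dn_queue_cong_below[OF assms(1,2) eq' i(1)]) (use i(2) in simp)+
  with eq'[OF i(2)] show "k \<in> cap D E \<longleftrightarrow> k \<in> cap D' E'" unfolding cap_def by simp
qed

text \<open>Without a server at \<open>Suc i\<close>, an arrival at \<open>Suc i\<close> waits until
  \<open>i\<close> and is then treated like an arrival at \<open>i\<close>.\<close>

lemma cap_sw_right:
  assumes "finite E" "Suc i \<in> E \<Longrightarrow> i \<in> E" "Suc i \<notin> D"
  shows "cap D (sw i E) = cap D E"
proof -
  have fin: "finite (sw i E)" using assms by simp
  note loc = cap_local[of "sw i E" E i D D, OF fin assms(1)]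
  define p where "p = dn_queue D E (Suc (Suc i))"
  have q: "dn_queue D (sw i E) (Suc (Suc i)) = p"
    unfolding p_def by (rule loc(2)) auto
  have s: "dn_queue D (sw i E) (Suc i) = p + of_bool (i \<in> E)"
    "dn_queue D E (Suc i) = p + of_bool (Suc i \<in> E)"
    using dn_queue_step[OF fin, of D "Suc i"] dn_queue_step[OF assms(1), of D "Suc i"] q assms(3)
    by (simp_all add: p_def)
  have t: "dn_queue D (sw i E) i = dn_queue D E i"
    unfolding dn_queue_step[OF fin, of D i] dn_queue_step[OF assms(1), of D i] s by simp
  show ?thesis
  proof (rule set_eq_at[of i])
    show "x \<in> cap D (sw i E) \<longleftrightarrow> x \<in> cap D E" if "x < i" for x
      by (rule loc(3)[OF _ t that]) auto
    show "x \<in> cap D (sw i E) \<longleftrightarrow> x \<in> cap D E" if "Suc i < x" for x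
      by (rule loc(1)[OF _ that]) auto
    show "i \<in> cap D (sw i E) \<longleftrightarrow> i \<in> cap D E"
      using assms(2) by (auto simp: cap_def s)
    show "Suc i \<in> cap D (sw i E) \<longleftrightarrow> Suc i \<in> cap D E"
      using assms(3) by (simp add: cap_def)
  qed
qed

text \<open>The only server at the two positions moves together with the arrivals. Whether it is
  busy and how long a queue is left at \<open>i\<close> stay the same.\<close>

lemma cap_sw_both:
  assumes "finite E" "Suc i \<in> E \<Longrightarrow> i \<in> E" "i \<in> D" "Suc i \<notin> D"
  shows "cap (sw i D) (sw i E) = sw i (cap D E)"
proof -
  have fin: "finite (sw i E)" using assms by simp
  note loc = cap_local[of "sw i E" E i "sw i D" D, OF fin assms(1)]
  define p where "p = dn_queue D E (Suc (Suc i))"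
  have q: "dn_queue (sw i D) (sw i E) (Suc (Suc i)) = p"
    unfolding p_def by (rule loc(2)) auto
  have s: "dn_queue (sw i D) (sw i E) (Suc i) = p + of_bool (i \<in> E) - 1"
    "dn_queue D E (Suc i) = p + of_bool (Suc i \<in> E)"
    using dn_queue_step[OF fin, of "sw i D" "Suc i"] dn_queue_step[OF assms(1), of D "Suc i"] q
      assms(3,4) by (simp_all add: p_def)
  have t: "dn_queue (sw i D) (sw i E) i = dn_queue D E i"
    unfolding dn_queue_step[OF fin, of "sw i D" i] dn_queue_step[OF assms(1), of D i] s
    using assms by (cases "i \<in> E"; cases "Suc i \<in> E"; simp)
  show ?thesis
  proof (rule set_eq_at[of i])
    show "x \<in> cap (sw i D) (sw i E) \<longleftrightarrow> x \<in> sw i (cap D E)" if "x < i" for x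
      unfolding mem_sw_simps(3)[OF that] by (rule loc(3)[OF _ t that]) auto
    show "x \<in> cap (sw i D) (sw i E) \<longleftrightarrow> x \<in> sw i (cap D E)" if "Suc i < x" for x
      unfolding mem_sw_simps(4)[OF that] by (rule loc(1)[OF _ that]) auto
    show "i \<in> cap (sw i D) (sw i E) \<longleftrightarrow> i \<in> sw i (cap D E)"
      using assms by (simp add: cap_def)
    show "Suc i \<in> cap (sw i D) (sw i E) \<longleftrightarrow> Suc i \<in> sw i (cap D E)"
      using assms by (auto simp: cap_def s q)
  qed
qed

text \<open>The first alternative occurs when there is an arrival at \<open>i\<close> only and
  nobody is waiting from above: then the server at the arrival is busy, the other one idles, and
  both roles move with the swap. In all other cases the same servers are busy before and
  after.\<close>

lemma cap_sw_full:
  assumes "finite E" "Suc i \<in> E \<Longrightarrow> i \<in> E" "i \<in> D" "Suc i \<in> D"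
  shows "cap D (sw i E) = sw i (cap D E) \<and> i \<in> cap D E \<and> Suc i \<notin> cap D E \<or>
    cap D (sw i E) = cap D E \<and> (i \<in> cap D E \<longrightarrow> Suc i \<in> cap D E)"
proof -
  have fin: "finite (sw i E)" using assms by simp
  note loc = cap_local[of "sw i E" E i D D, OF fin assms(1)]
  define p where "p = dn_queue D E (Suc (Suc i))"
  have q: "dn_queue D (sw i E) (Suc (Suc i)) = p"
    unfolding p_def by (rule loc(2)) auto
  have s: "dn_queue D (sw i E) (Suc i) = p + of_bool (i \<in> E) - 1"
    "dn_queue D E (Suc i) = p + of_bool (Suc i \<in> E) - 1"
    using dn_queue_step[OF fin, of D "Suc i"] dn_queue_step[OF assms(1), of D "Suc i"] q assms(4)
    by (simp_all add: p_def)
  have t: "dn_queue D (sw i E) i = dn_queue D E i"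
    unfolding dn_queue_step[OF fin, of D i] dn_queue_step[OF assms(1), of D i] s
    using assms by (cases "i \<in> E"; cases "Suc i \<in> E"; cases p; simp)
  have below: "x \<in> cap D (sw i E) \<longleftrightarrow> x \<in> cap D E" if "x < i" for x
    by (rule loc(3)[OF _ t that]) auto
  have above: "x \<in> cap D (sw i E) \<longleftrightarrow> x \<in> cap D E" if "Suc i < x" for x
    by (rule loc(1)[OF _ that]) auto
  have m: "i \<in> cap D E \<longleftrightarrow> i \<in> E \<or> 1 < p + of_bool (Suc i \<in> E)"
    "Suc i \<in> cap D E \<longleftrightarrow> Suc i \<in> E \<or> 0 < p"
    "i \<in> cap D (sw i E) \<longleftrightarrow> Suc i \<in> E \<or> 1 < p + of_bool (i \<in> E)"
    "Suc i \<in> cap D (sw i E) \<longleftrightarrow> i \<in> E \<or> 0 < p"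
    using assms(3,4) by (auto simp: cap_def s q p_def[symmetric])
  show ?thesis
  proof (cases "i \<in> E \<and> Suc i \<notin> E \<and> p = 0")
    case True
    then have "cap D (sw i E) = sw i (cap D E)"
      by (intro set_eq_at[of i]) (use below above in \<open>simp_all add: m\<close>)
    with True show ?thesis by (simp add: m)
  next
    case False
    then have "cap D (sw i E) = cap D E"
      using assms(2)
      by (intro set_eq_at[of i]) (use below above in \<open>auto simp: m\<close>)
    with False show ?thesis using assms(2) by (auto simp: m)
  qed
qed

subsection \<open>Sums over bounded columns\<close>

definition extras :: "nat set \<Rightarrow> nat set \<Rightarrow> nat set" where
  "extras C D = {k. k \<notin> C \<and> cnt D (Suc k) < cnt C (Suc k)}"

definition col_weight :: "nat set \<Rightarrow> nat set \<Rightarrow> beta_mpoly" where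
  "col_weight C D = (\<Prod>k\<in>extras C D. 1 + beta * var k)"

definition col_monom :: "nat set \<Rightarrow> beta_mpoly" where
  "col_monom D = (\<Prod>a\<in>D. var a)"

text \<open>\<open>C\<close> is the column to the left of those summed over. Its factors depend on
  the next column, so they are supplied once \<open>D\<close> is chosen; the right neighbour of the
  last column is empty.\<close>

fun Phi :: "nat set \<Rightarrow> nat set list \<Rightarrow> beta_mpoly" where
  "Phi C [] = col_weight C {}"
| "Phi C (E # Es) =
     (\<Sum>D | dom_le D E. col_weight C D * col_monom D * Phi D (map (cap D) Es))"

lemma finite_extras:
  assumes "finite C"
  shows "finite (extras C D)"
proof -
  obtain N where N: "\<And>x. x \<in> C \<Longrightarrow> x < N" using finite_bounded[OF assms assms] by metis
  have "k < N" if "k \<in> extras C D" for k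
  proof (rule ccontr)
    assume "\<not> k < N"
    then have "cnt C (Suc k) = 0" using N by (intro cnt_eq_0) (metis less_SucI less_le_trans not_less)
    with that show False by (simp add: extras_def)
  qed
  then have "extras C D \<subseteq> {..<N}" by blast
  then show ?thesis by (rule finite_subset) simp
qed

text \<open>The swap can only raise a count of \<open>E\<close>, namely at \<open>Suc i\<close>.
  Conversely, the inequality at \<open>Suc i\<close> follows from those at \<open>i\<close> and
  \<open>Suc (Suc i)\<close>, since \<open>D\<close> does not contain \<open>Suc i\<close> without
  \<open>i\<close>.\<close>

lemma dom_le_sw_right:
  assumes "finite E" "Suc i \<in> E \<Longrightarrow> i \<in> E" "Suc i \<in> D \<Longrightarrow> i \<in> D"
  shows "dom_le D (sw i E) \<longleftrightarrow> dom_le D E"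
proof (cases "finite D")
  case fD: True
  have "cnt D k \<le> cnt (sw i E) k" if le: "\<And>k. cnt D k \<le> cnt E k" for k
  proof (cases "k = Suc i")
    case True
    have "cnt E (Suc i) \<le> cnt (sw i E) (Suc i)"
      using cnt_step[OF assms(1), of "Suc i"] cnt_step[of "sw i E" "Suc i"] assms(1,2)
      by (auto simp: cnt_sw)
    with True le[of k] show ?thesis by simp
  qed (use le[of k] in \<open>simp add: cnt_sw\<close>)
  moreover have "cnt D k \<le> cnt E k" if le: "\<And>k. cnt D k \<le> cnt (sw i E) k" for k
  proof (cases "k = Suc i")
    case True
    have "cnt D (Suc (Suc i)) \<le> cnt E (Suc (Suc i))" "cnt D i \<le> cnt E i"
      using le[of "Suc (Suc i)"] le[of i] by (simp_all add: cnt_sw)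
    then show ?thesis
      using cnt_step[OF fD, of i] cnt_step[OF fD, of "Suc i"]
        cnt_step[OF assms(1), of i] cnt_step[OF assms(1), of "Suc i"] assms(2,3) True
      by (auto simp: of_bool_def split: if_splits)
  qed (use le[of k] in \<open>simp add: cnt_sw\<close>)
  ultimately show ?thesis unfolding dom_le_def by auto
qed (simp add: dom_le_def)

lemma dom_le_sw_both:
  assumes "finite E" "Suc i \<in> E \<Longrightarrow> i \<in> E" "i \<in> D" "Suc i \<notin> D"
  shows "dom_le (sw i D) (sw i E) \<longleftrightarrow> dom_le D E"
proof (cases "finite D")
  case fD: True
  have "cnt (sw i D) k \<le> cnt (sw i E) k" if le: "\<And>k. cnt D k \<le> cnt E k" for k
  proof (cases "k = Suc i")
    case True
    then show ?thesis
      using le[of "Suc (Suc i)"] le[of i] cnt_step[OF fD, of i] cnt_step[OF fD, of "Suc i"]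
        cnt_step[OF assms(1), of i] cnt_step[OF assms(1), of "Suc i"] assms
        cnt_step[of "sw i E" "Suc i"] cnt_step[of "sw i D" "Suc i"] fD
      by (auto simp: cnt_sw of_bool_def split: if_splits)
  qed (use le[of k] in \<open>simp add: cnt_sw\<close>)
  moreover have "cnt D k \<le> cnt E k" if le: "\<And>k. cnt (sw i D) k \<le> cnt (sw i E) k" for k
  proof (cases "k = Suc i")
    case True
    then show ?thesis
      using le[of "Suc (Suc i)"] cnt_step[OF fD, of "Suc i"] cnt_step[OF assms(1), of "Suc i"] assms
      by (auto simp: cnt_sw of_bool_def split: if_splits)
  qed (use le[of k] in \<open>simp add: cnt_sw\<close>)
  ultimately show ?thesis using fD unfolding dom_le_def by auto
qed (simp add: dom_le_def)

lemma sum_dom_le_split: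
  fixes f :: "nat set \<Rightarrow> 'a :: comm_monoid_add"
  assumes "finite E"
  shows "(\<Sum>D | dom_le D E. f D) =
    (\<Sum>D | dom_le D E \<and> i \<notin> D \<and> Suc i \<notin> D. f D) + (\<Sum>D | dom_le D E \<and> i \<in> D \<and> Suc i \<in> D. f D) +
    (\<Sum>D | dom_le D E \<and> i \<in> D \<and> Suc i \<notin> D. f D) + (\<Sum>D | dom_le D E \<and> i \<notin> D \<and> Suc i \<in> D. f D)"
proof -
  note fin = finite_dom_le[OF assms]
  have split: "(\<Sum>D | P D. f D) = (\<Sum>D | P D \<and> Q D. f D) + (\<Sum>D | P D \<and> \<not> Q D. f D)"
    if "finite {D. P D}" for P Q
    using that by (subst sum.union_disjoint[symmetric]) (auto intro!: sum.cong)
  show ?thesis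
    using split[OF fin, of "\<lambda>D. i \<in> D"]
      split[of "\<lambda>D. dom_le D E \<and> i \<in> D" "\<lambda>D. Suc i \<in> D"]
      split[of "\<lambda>D. dom_le D E \<and> i \<notin> D" "\<lambda>D. Suc i \<in> D"] fin
    by (simp add: add_ac)
qed

text \<open>Only columns with \<open>Suc i\<close> but not \<open>i\<close> feel the swap of the
  bound. Those below \<open>sw i E\<close> correspond under \<open>sw i\<close> to the columns below
  \<open>E\<close> with \<open>i\<close> but not \<open>Suc i\<close>, which gives the pairs in the
  last sum.\<close>

lemma sum_dom_le_sw_split:
  fixes f :: "nat set \<Rightarrow> 'a :: comm_monoid_add"
  assumes "finite E" "Suc i \<in> E \<Longrightarrow> i \<in> E"
  shows "(\<Sum>D | dom_le D (sw i E). f D) =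
    (\<Sum>D | dom_le D E \<and> i \<notin> D \<and> Suc i \<notin> D. f D) + (\<Sum>D | dom_le D E \<and> i \<in> D \<and> Suc i \<in> D. f D) +
    (\<Sum>D | dom_le D E \<and> i \<in> D \<and> Suc i \<notin> D. f D + f (sw i D))"
proof -
  have "(\<Sum>D | dom_le D (sw i E) \<and> i \<notin> D \<and> Suc i \<in> D. f D) =
    (\<Sum>D | dom_le D E \<and> i \<in> D \<and> Suc i \<notin> D. f (sw i D))"
  proof (rule sum.reindex_bij_witness[of _ "sw i" "sw i"])
    fix D assume "D \<in> {D. dom_le D (sw i E) \<and> i \<notin> D \<and> Suc i \<in> D}"
    then show "sw i D \<in> {D. dom_le D E \<and> i \<in> D \<and> Suc i \<notin> D}"
      using dom_le_sw_both[OF assms, where D = "sw i D"] by simp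
  qed (use dom_le_sw_both[OF assms] in auto)
  moreover have "{D. dom_le D (sw i E) \<and> i \<notin> D \<and> Suc i \<notin> D} = {D. dom_le D E \<and> i \<notin> D \<and> Suc i \<notin> D}"
    "{D. dom_le D (sw i E) \<and> i \<in> D \<and> Suc i \<in> D} = {D. dom_le D E \<and> i \<in> D \<and> Suc i \<in> D}"
    "{D. dom_le D (sw i E) \<and> i \<in> D \<and> Suc i \<notin> D} = {D. dom_le D E \<and> i \<in> D \<and> Suc i \<notin> D}"
    using dom_le_sw_right[OF assms] by auto
  ultimately show ?thesis
    using sum_dom_le_split[of "sw i E" f i] assms(1) by (simp add: sum.distrib add_ac)
qed

text \<open>
  The columns with \<open>Suc i\<close> but not \<open>i\<close> that are below \<open>E\<close> have no counterpart below \<open>sw i E\<close>; they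
  have to be annihilated by the operator.
\<close>

lemma sum_dom_le_operator:
  fixes Op :: "beta_mpoly \<Rightarrow> beta_mpoly"
  assumes "finite E" "Suc i \<in> E \<Longrightarrow> i \<in> E"
    and add: "\<And>f g. Op (f + g) = Op f + Op g" and zero: "Op 0 = 0"
    and "\<And>D. dom_le D E \<Longrightarrow> i \<notin> D \<Longrightarrow> Suc i \<notin> D \<Longrightarrow> t' D = Op (t D)"
    and "\<And>D. dom_le D E \<Longrightarrow> i \<in> D \<Longrightarrow> Suc i \<in> D \<Longrightarrow> t' D = Op (t D)"
    and "\<And>D. dom_le D E \<Longrightarrow> i \<in> D \<Longrightarrow> Suc i \<notin> D \<Longrightarrow> t' D + t' (sw i D) = Op (t D)"
    and "\<And>D. dom_le D E \<Longrightarrow> i \<notin> D \<Longrightarrow> Suc i \<in> D \<Longrightarrow> Op (t D) = 0"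
  shows "(\<Sum>D | dom_le D (sw i E). t' D) = Op (\<Sum>D | dom_le D E. t D)"
proof -
  have "Suc i \<in> E \<longrightarrow> i \<in> E" using assms(2) by blast
  then show ?thesis
    unfolding sum_dom_le_split[OF assms(1), of t i]
    by (subst sum_dom_le_sw_split[OF assms(1)])
      (auto simp: add sum_comp_morphism[of Op, OF zero add, symmetric] assms(5-8))
qed

section \<open>Local factors at two adjacent letters\<close>

definition far_weight :: "nat \<Rightarrow> nat set \<Rightarrow> nat set \<Rightarrow> beta_mpoly" where
  "far_weight i C D =
     (\<Prod>k\<in>extras C D - {i, Suc i}. 1 + beta * var k) * (\<Prod>a\<in>D - {i, Suc i}. var a)"

lemma swap_vars_far_weight [simp]: "swap_vars i (far_weight i C D) = far_weight i C D"
  by (auto simp: far_weight_def swap_vars_mult swap_vars_prod swap_vars_add swap_vars_var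
      transpose_def intro!: arg_cong2[of _ _ _ _ "(*)"] prod.cong)

lemma mem_sw_far: "k \<noteq> i \<Longrightarrow> k \<noteq> Suc i \<Longrightarrow> k \<in> sw i A \<longleftrightarrow> k \<in> A"
  by (simp add: mem_sw transpose_def)

text \<open>A swap alters counts only at the threshold \<open>Suc i\<close>, which enters
  \<open>extras\<close> only for the letter \<open>i\<close>.\<close>

lemma far_weight_sw [simp]:
  "far_weight i (sw i C) D = far_weight i C D" "far_weight i C (sw i D) = far_weight i C D"
proof -
  have "extras (sw i C) D - {i, Suc i} = extras C D - {i, Suc i}"
    "extras C (sw i D) - {i, Suc i} = extras C D - {i, Suc i}"
    by (auto simp: extras_def cnt_sw mem_sw_far)
  moreover have "sw i D - {i, Suc i} = D - {i, Suc i}"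
    by (auto simp: mem_sw_far)
  ultimately show "far_weight i (sw i C) D = far_weight i C D"
    "far_weight i C (sw i D) = far_weight i C D"
    by (simp_all only: far_weight_def)
qed

lemma prod_split_two:
  assumes "finite A" "i \<noteq> j"
  shows "prod f A = prod f (A - {i, j}) * (if j \<in> A then f j else 1) * (if i \<in> A then f i else 1)"
proof -
  have "prod f A = prod f (A - {i, j}) * prod f (A \<inter> {i, j})"
    using assms by (subst prod.union_disjoint[symmetric]) (auto intro!: prod.cong)
  moreover have "prod f (A \<inter> {i, j}) = (if j \<in> A then f j else 1) * (if i \<in> A then f i else 1)"
    using assms(2) by (cases "i \<in> A"; cases "j \<in> A") (simp_all add: mult.commute)
  ultimately show ?thesis by (simp add: mult.assoc)
qed

lemma weight_split:
  assumes "finite C" "finite D"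
  shows "col_weight C D * col_monom D = far_weight i C D *
    (if Suc i \<notin> C \<and> cnt D (Suc (Suc i)) < cnt C (Suc (Suc i)) then 1 + beta * var (Suc i) else 1) *
    (if i \<notin> C \<and> cnt D (Suc i) < cnt C (Suc i) then 1 + beta * var i else 1) *
    (if i \<in> D then var i else 1) * (if Suc i \<in> D then var (Suc i) else 1)"
  unfolding col_weight_def col_monom_def far_weight_def
  unfolding prod_split_two[OF finite_extras[OF assms(1)] n_not_Suc_n[of i]]
    prod_split_two[OF assms(2) n_not_Suc_n[of i]]
  by (simp add: extras_def mult_ac)

lemma demazure_lascoux_var_mult:
  "demazure_lascoux i (var i * f) =
    var i * f + var (Suc i) * ((1 + beta * var i) * divided_diff i (var i * f))"
  by (simp add: demazure_lascoux_eq mult_ac)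

lemma divided_diff_weight_mult:
  "divided_diff i (var i * ((1 + beta * var (Suc i)) * f)) = demazure_lascoux i f"
  by (simp add: demazure_lascoux_def mult_ac)

lemma divided_diff_var_mult:
  "divided_diff i (var i * f) = f + var (Suc i) * divided_diff i f"
  by (simp add: divided_diff_product swap_vars_var)

text \<open>The weight inserted by the operator completes the argument to a symmetric product, which
  the divided difference annihilates.\<close>

lemma demazure_lascoux_eq_0:
  "swap_vars i h = h \<Longrightarrow> demazure_lascoux i (var (Suc i) * ((1 + beta * var i) * h)) = 0"
  unfolding demazure_lascoux_def
  by (rule divided_diff_symmetric) (simp add: swap_vars_mult swap_vars_add swap_vars_var mult_ac)

definition chain_below :: "nat set \<Rightarrow> nat set list \<Rightarrow> bool" where
  "chain_below C Es \<longleftrightarrow> finite C \<and> sorted_wrt (\<supseteq>) Es \<and> (\<forall>E\<in>set Es. E \<subseteq> C)"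

lemma chain_below_cap:
  assumes "finite D" "sorted_wrt (\<supseteq>) Es" "\<forall>E\<in>set Es. finite E"
  shows "chain_below D (map (cap D) Es)"
  using assms unfolding chain_below_def
  by (auto simp: sorted_wrt_map cap_subset intro: sorted_wrt_mono_rel[of _ "(\<supseteq>)"] cap_mono[THEN subsetD]
      dest: cap_subset[THEN subsetD])

lemma chain_below_sw: "chain_below C Es \<Longrightarrow> chain_below (sw i C) (map (sw i) Es)"
  by (auto simp: chain_below_def sorted_wrt_map)

subsection \<open>Exchanging two adjacent letters\<close>

text \<open>Both \<open>var i\<close> and \<open>(1 + beta * var (Suc i)) * var i\<close> have
  divided difference 1, and the symmetric factor passes through.\<close>

lemma divided_diff_weight_symmetric:
  assumes "swap_vars i f = f"
  shows "divided_diff i (var i * ((if b then 1 + beta * var (Suc i) else 1) * f)) = f"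
proof (cases b)
  case True
  then show ?thesis
    using assms by (simp only: if_True divided_diff_weight_mult demazure_lascoux_symmetric)
next
  case False
  then show ?thesis
    using assms by (simp add: divided_diff_var_mult divided_diff_symmetric)
qed

lemma pair_weights:
  fixes w y z a b f g :: "'a :: comm_semiring_1"
  shows "w * y * z * a * f + w * y * z * b * (z * g) = w * y * z * (a * f + b * (z * g))"
    "w * y * z * a * f + w * y * b * (z * g) = w * y * z * (a * f + b * g)"
  by (simp_all add: distrib_left mult_ac)

text \<open>The inductive step for a list of bounds headed by \<open>E\<close>. The hypotheses range
  over all lists as long as \<open>Es\<close> and all preceding columns, because after the choice of
  \<open>D\<close> they are applied to the bounds \<open>cap D F\<close> with \<open>F\<close> in
  \<open>Es\<close>.\<close>

locale swap_step =
  fixes i :: nat and E :: "nat set" and Es :: "nat set list"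
  assumes finite_E: "finite E"
    and chain: "sorted_wrt (\<supseteq>) (E # Es)"
    and ascent: "F \<in> set (E # Es) \<Longrightarrow> Suc i \<in> F \<Longrightarrow> i \<in> F"
    and IH_both: "\<And>C Fs. length Fs = length Es \<Longrightarrow> chain_below C Fs \<Longrightarrow> i \<in> C \<Longrightarrow> Suc i \<in> C \<Longrightarrow>
      (\<And>F. F \<in> set Fs \<Longrightarrow> Suc i \<in> F \<Longrightarrow> i \<in> F) \<Longrightarrow>
      Phi C (map (sw i) Fs) = demazure_lascoux i (Phi C Fs)"
    and IH_neither: "\<And>C Fs. length Fs = length Es \<Longrightarrow> chain_below C Fs \<Longrightarrow> i \<notin> C \<Longrightarrow> Suc i \<notin> C \<Longrightarrow>
      swap_vars i (Phi C Fs) = Phi C Fs"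
    and IH_one: "\<And>C Fs. length Fs = length Es \<Longrightarrow> chain_below C Fs \<Longrightarrow> i \<in> C \<Longrightarrow> Suc i \<notin> C \<Longrightarrow>
      Phi (sw i C) (map (sw i) Fs) =
        (1 + beta * var i) * divided_diff i (var i * Phi C Fs)"
begin

definition tail :: "nat set \<Rightarrow> beta_mpoly" where
  "tail D = Phi D (map (cap D) Es)"

definition tail_sw :: "nat set \<Rightarrow> beta_mpoly" where
  "tail_sw D = Phi D (map (cap D) (map (sw i) Es))"

lemma finite_Es: "F \<in> set Es \<Longrightarrow> finite F"
  using chain finite_E by (auto intro: finite_subset)

lemma chain_below_cap': "dom_le D E \<Longrightarrow> chain_below D (map (cap D) Es)"
  using chain finite_Es by (intro chain_below_cap) (auto simp: dom_le_def)

lemma tail_sw_eq: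
  assumes "Suc i \<notin> D"
  shows "tail_sw D = tail D"
proof -
  have "cap D (sw i F) = cap D F" if "F \<in> set Es" for F
    using that assms ascent finite_Es by (intro cap_sw_right) auto
  then have "map (cap D) (map (sw i) Es) = map (cap D) Es" by simp
  then show ?thesis unfolding tail_def tail_sw_def by (simp only:)
qed

lemma tail_neither:
  assumes "dom_le D E" "i \<notin> D" "Suc i \<notin> D"
  shows "swap_vars i (tail D) = tail D"
  unfolding tail_def using assms by (intro IH_neither chain_below_cap') auto

text \<open>The alternative in \<open>cap_sw_full\<close> has to be resolved uniformly for all
  bounds. The sets \<open>cap D F\<close> form a chain, so if one of them contains \<open>i\<close>
  but not \<open>Suc i\<close>, then none contains \<open>Suc i\<close> without \<open>i\<close>,
  and \<open>IH_both\<close> applies to them directly.\<close>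

lemma tail_both:
  assumes "dom_le D E" "i \<in> D" "Suc i \<in> D"
  shows "tail_sw D = demazure_lascoux i (tail D)"
proof -
  have cases: "cap D (sw i F) = sw i (cap D F) \<and> i \<in> cap D F \<and> Suc i \<notin> cap D F \<or>
    cap D (sw i F) = cap D F \<and> (i \<in> cap D F \<longrightarrow> Suc i \<in> cap D F)" if "F \<in> set Es" for F
    using that assms ascent finite_Es by (intro cap_sw_full) auto
  have comparable: "cap D F \<subseteq> cap D G \<or> cap D G \<subseteq> cap D F" if FG: "F \<in> set Es" "G \<in> set Es" for F G
  proof -
    obtain a b where "a < length Es" "b < length Es" "F = Es ! a" "G = Es ! b"
      using FG by (metis in_set_conv_nth)
    moreover have "sorted_wrt (\<supseteq>) Es" using chain by simp
    ultimately have "F \<subseteq> G \<or> G \<subseteq> F"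
      using sorted_wrt_nth_less by (cases a b rule: linorder_cases) blast+
    with FG show ?thesis using cap_mono finite_Es by metis
  qed
  note cb = chain_below_cap'[OF assms(1)]
  show ?thesis
  proof (cases "\<exists>F\<in>set Es. i \<in> cap D F \<and> Suc i \<notin> cap D F")
    case True
    then obtain F where F: "F \<in> set Es" "i \<in> cap D F" "Suc i \<notin> cap D F" by blast
    have asc: "i \<in> cap D G" if "G \<in> set Es" "Suc i \<in> cap D G" for G
      using comparable[OF F(1) that(1)] F that(2) by blast
    have "cap D (sw i G) = sw i (cap D G)" if G: "G \<in> set Es" for G
      using cases[OF G] asc[OF G] sw_eq_self[of i "cap D G"] by metis
    then have "map (cap D) (map (sw i) Es) = map (sw i) (map (cap D) Es)" by simp
    moreover have "Phi D (map (sw i) (map (cap D) Es)) = demazure_lascoux i (tail D)"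
      unfolding tail_def using assms cb asc by (intro IH_both) auto
    ultimately show ?thesis unfolding tail_sw_def by (simp only:)
  next
    \<comment> \<open>Now the swap changes no bound, and every bound containing \<open>i\<close>
      contains \<open>Suc i\<close>. \<open>IH_both\<close> for the swapped list puts
      \<open>tail D\<close> into the image of the operator, so it is symmetric and therefore
      fixed.\<close>
    case False
    then have eq: "map (cap D) (map (sw i) Es) = map (cap D) Es"
      using cases by auto
    have "chain_below D (map (sw i) (map (cap D) Es))"
      using chain_below_sw[OF cb, of i] sw_eq_self[of i D] assms by simp
    then have "Phi D (map (sw i) (map (sw i) (map (cap D) Es))) =
      demazure_lascoux i (Phi D (map (sw i) (map (cap D) Es)))"
      using assms False by (intro IH_both) auto
    then have "tail D = demazure_lascoux i (Phi D (map (sw i) (map (cap D) Es)))"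
      by (simp add: tail_def comp_def)
    then have "swap_vars i (tail D) = tail D" by simp
    moreover have "tail_sw D = tail D" unfolding tail_def tail_sw_def eq ..
    ultimately show ?thesis by (simp add: demazure_lascoux_symmetric)
  qed
qed

lemma tail_one:
  assumes "dom_le D E" "i \<in> D" "Suc i \<notin> D"
  shows "tail_sw (sw i D) = (1 + beta * var i) * divided_diff i (var i * tail D)"
proof -
  have "cap (sw i D) (sw i F) = sw i (cap D F)" if "F \<in> set Es" for F
    using that assms ascent finite_Es by (intro cap_sw_both) auto
  then have "map (cap (sw i D)) (map (sw i) Es) = map (sw i) (map (cap D) Es)" by simp
  moreover have "Phi (sw i D) (map (sw i) (map (cap D) Es)) =
      (1 + beta * var i) * divided_diff i (var i * tail D)"
    unfolding tail_def using assms by (intro IH_one chain_below_cap') auto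
  ultimately show ?thesis unfolding tail_sw_def by (simp only:)
qed

text \<open>Exchanging the two letters in \<open>D\<close> and in the bounds leads to the situation
  of \<open>IH_one\<close>; \<open>h\<close> is the divided difference occurring there.\<close>

lemma tail_other:
  assumes "dom_le D E" "i \<notin> D" "Suc i \<in> D"
  obtains h where "swap_vars i h = h" "tail D = (1 + beta * var i) * h"
proof
  let ?Fs = "map (sw i) (map (cap D) Es)"
  have "chain_below (sw i D) ?Fs"
    using chain_below_sw[OF chain_below_cap'[OF assms(1)]] .
  then have "Phi (sw i (sw i D)) (map (sw i) ?Fs) =
      (1 + beta * var i) * divided_diff i (var i * Phi (sw i D) ?Fs)"
    using assms by (intro IH_one) auto
  then show "tail D = (1 + beta * var i) * divided_diff i (var i * Phi (sw i D) ?Fs)"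
    by (simp add: tail_def comp_def)
qed simp

text \<open>As \<open>C\<close> contains both letters, it has no factor at either. Columns
  \<open>D\<close> with none or both of the letters contribute symmetric multiples of their tails,
  the pairs \<open>D\<close>, \<open>sw i D\<close> combine by
  \<open>demazure_lascoux_var_mult\<close>, and the remaining columns are annihilated.\<close>

lemma Phi_both:
  assumes "finite C" "i \<in> C" "Suc i \<in> C"
  shows "Phi C (map (sw i) (E # Es)) = demazure_lascoux i (Phi C (E # Es))"
  unfolding list.map(2) Phi.simps tail_def[symmetric] tail_sw_def[symmetric]
proof (rule sum_dom_le_operator)
  show "finite E" by (rule finite_E)
  show "i \<in> E" if "Suc i \<in> E" using ascent that by auto
  show "demazure_lascoux i (f + g) = demazure_lascoux i f + demazure_lascoux i g" for f g
    by (rule demazure_lascoux_add)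
  show "demazure_lascoux i 0 = 0" by (simp add: demazure_lascoux_symmetric)
next
  fix D assume D: "dom_le D E" "i \<notin> D" "Suc i \<notin> D"
  show "col_weight C D * col_monom D * tail_sw D =
    demazure_lascoux i (col_weight C D * col_monom D * tail D)"
    using assms D tail_neither[OF D]
    by (simp add: weight_split[OF assms(1) dom_leD(1)[OF D(1)], of i] tail_sw_eq
        demazure_lascoux_symmetric swap_vars_mult)
next
  fix D assume D: "dom_le D E" "i \<in> D" "Suc i \<in> D"
  have "demazure_lascoux i (far_weight i C D * var i * var (Suc i) * tail D) =
     far_weight i C D * var i * var (Suc i) * demazure_lascoux i (tail D)"
    by (rule demazure_lascoux_const_mult) (simp add: swap_vars_mult swap_vars_var mult_ac)
  then show "col_weight C D * col_monom D * tail_sw D =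
    demazure_lascoux i (col_weight C D * col_monom D * tail D)"
    using assms D
    by (simp add: weight_split[OF assms(1) dom_leD(1)[OF D(1)], of i] tail_both)
next
  fix D assume D: "dom_le D E" "i \<in> D" "Suc i \<notin> D"
  have fin: "finite D" using D(1) by (rule dom_leD)
  have "demazure_lascoux i (far_weight i C D * (var i * tail D)) =
     far_weight i C D * demazure_lascoux i (var i * tail D)"
    by (rule demazure_lascoux_const_mult) simp
  then show "col_weight C D * col_monom D * tail_sw D +
      col_weight C (sw i D) * col_monom (sw i D) * tail_sw (sw i D) =
    demazure_lascoux i (col_weight C D * col_monom D * tail D)"
    using assms D fin
    by (simp add: weight_split[OF assms(1), of _ i] tail_one tail_sw_eq
        demazure_lascoux_var_mult distrib_left mult.assoc)
next
  fix D assume D: "dom_le D E" "i \<notin> D" "Suc i \<in> D"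
  have fin: "finite D" using D(1) by (rule dom_leD)
  obtain h where h: "swap_vars i h = h" "tail D = (1 + beta * var i) * h"
    using tail_other[OF D] .
  have "demazure_lascoux i (far_weight i C D * (var (Suc i) * ((1 + beta * var i) * h))) =
     far_weight i C D * demazure_lascoux i (var (Suc i) * ((1 + beta * var i) * h))"
    by (rule demazure_lascoux_const_mult) simp
  then show "demazure_lascoux i (col_weight C D * col_monom D * tail D) = 0"
    using assms D fin h
    by (simp add: weight_split[OF assms(1), of _ i] demazure_lascoux_eq_0 mult.assoc)
qed

lemma cnt_steps:
  assumes "finite A"
  shows "cnt A i = cnt A (Suc (Suc i)) + of_bool (i \<in> A) + of_bool (Suc i \<in> A)"
    "cnt A (Suc i) = cnt A (Suc (Suc i)) + of_bool (Suc i \<in> A)"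
  using cnt_step[OF assms, of i] cnt_step[OF assms, of "Suc i"] by simp_all

text \<open>The bounds lie in \<open>C\<close>, so they contain neither letter and equal their
  swaps. Hence the sum may be split as for \<open>sw i E\<close>, and then each single term and each
  pair \<open>D\<close>, \<open>sw i D\<close> is symmetric on its own.\<close>

lemma Phi_neither:
  assumes "finite C" "E \<subseteq> C" "i \<notin> C" "Suc i \<notin> C"
  shows "swap_vars i (Phi C (E # Es)) = Phi C (E # Es)"
proof -
  let ?t = "\<lambda>D. col_weight C D * col_monom D * tail D"
  have sub: "F \<subseteq> C" if "F \<in> set (E # Es)" for F using that chain assms(2) by auto
  have sw_eq: "sw i F = F" if "F \<in> set (E # Es)" for F
    using sub[OF that] assms by (intro sw_eq_self) auto
  then have tail_sw: "tail_sw D = tail D" for D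
    unfolding tail_def tail_sw_def by (intro arg_cong2[of _ _ _ _ Phi]) auto
  \<comment> \<open>These inequalities settle the conditionals in \<open>weight_split\<close>: the
    factors at \<open>i\<close> and \<open>Suc i\<close> occur together or not at all, except for
    columns \<open>sw i D\<close> containing \<open>Suc i\<close> only, which need the case
    distinction below.\<close>
  have le: "cnt D i \<le> cnt C (Suc (Suc i))" "cnt D (Suc i) \<le> cnt C (Suc (Suc i))"
    "cnt C (Suc i) = cnt C (Suc (Suc i))" if "dom_le D E" for D
    using dom_leD(3)[OF that, of i] dom_leD(3)[OF that, of "Suc i"]
      cnt_mono[OF assms(1,2), of i] cnt_mono[OF assms(1,2), of "Suc i"]
      cnt_steps[OF assms(1)] assms by simp_all
  have "Phi C (E # Es) = (\<Sum>D | dom_le D (sw i E). ?t D)"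
    by (simp add: sw_eq tail_def)
  also have "\<dots> =
    (\<Sum>D | dom_le D E \<and> i \<notin> D \<and> Suc i \<notin> D. ?t D) + (\<Sum>D | dom_le D E \<and> i \<in> D \<and> Suc i \<in> D. ?t D) +
    (\<Sum>D | dom_le D E \<and> i \<in> D \<and> Suc i \<notin> D. ?t D + ?t (sw i D))"
    using ascent by (intro sum_dom_le_sw_split finite_E) auto
  finally have eq: "Phi C (E # Es) = \<dots>" .
  have "swap_vars i (?t D) = ?t D" if D: "dom_le D E" "i \<notin> D" "Suc i \<notin> D" for D
  proof -
    have "swap_vars i (col_weight C D * col_monom D) = col_weight C D * col_monom D"
      unfolding weight_split[OF assms(1) dom_leD(1)[OF D(1)], of i]
      using D le[OF D(1)] assms cnt_steps[OF dom_leD(1)[OF D(1)]]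
      by (simp add: swap_vars_mult swap_vars_add swap_vars_var mult_ac)
    then show ?thesis using tail_neither[OF D] by (simp add: swap_vars_mult)
  qed
  moreover have "swap_vars i (?t D) = ?t D" if D: "dom_le D E" "i \<in> D" "Suc i \<in> D" for D
  proof -
    have "swap_vars i (tail D) = tail D"
      using tail_both[OF D] by (metis tail_sw swap_vars_demazure_lascoux)
    moreover have "swap_vars i (col_weight C D * col_monom D) = col_weight C D * col_monom D"
      unfolding weight_split[OF assms(1) dom_leD(1)[OF D(1)], of i]
      using D le[OF D(1)] assms cnt_steps[OF dom_leD(1)[OF D(1)]]
      by (simp add: swap_vars_mult swap_vars_add swap_vars_var mult_ac)
    ultimately show ?thesis by (simp add: swap_vars_mult)
  qed
  moreover have "swap_vars i (?t D + ?t (sw i D)) = ?t D + ?t (sw i D)"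
    if D: "dom_le D E" "i \<in> D" "Suc i \<notin> D" for D
  proof -
    have fin: "finite D" using D(1) by (rule dom_leD)
    let ?y = "1 + beta * var (Suc i)" and ?z = "1 + beta * var i" and ?X = "var i"
      and ?Y = "var (Suc i)" and ?w = "far_weight i C D"
    have tails: "tail (sw i D) = ?z * divided_diff i (?X * tail D)"
      using tail_one[OF D] tail_sw by metis
    have wD: "col_weight C D * col_monom D = ?w * ?y * ?z * ?X"
      using D le[OF D(1)] assms cnt_steps[OF fin]
      by (simp add: weight_split[OF assms(1) fin, of i])
    have cnt': "cnt (sw i D) (Suc i) = Suc (cnt D (Suc (Suc i)))"
      "cnt (sw i D) (Suc (Suc i)) = cnt D (Suc (Suc i))"
      using cnt_steps[of "sw i D"] fin D by (simp_all add: cnt_sw)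
    show ?thesis
    proof (cases "Suc (cnt D (Suc (Suc i))) < cnt C (Suc (Suc i))")
      case True
      have "col_weight C (sw i D) * col_monom (sw i D) = ?w * ?y * ?z * ?Y"
        using D le[OF D(1)] assms cnt' fin True
        by (simp add: weight_split[OF assms(1), of _ i])
      then have "?t D + ?t (sw i D) = ?w * ?y * ?z * demazure_lascoux i (?X * tail D)"
        unfolding wD tails demazure_lascoux_var_mult by (simp only: pair_weights)
      then show ?thesis
        by (simp add: swap_vars_mult swap_vars_add swap_vars_var mult_ac)
    next
      \<comment> \<open>Here the weight of \<open>sw i D\<close> lacks the factor
        \<open>1 + beta * var i\<close>, but its tail supplies one, so the pair is still a symmetric
        multiple of a divided difference.\<close>
      case False
      have "col_weight C (sw i D) * col_monom (sw i D) = ?w * ?y * ?Y"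
        using D le[OF D(1)] assms cnt' fin False cnt_steps[OF fin]
        by (simp add: weight_split[OF assms(1), of _ i])
      then have "?t D + ?t (sw i D) = ?w * ?y * ?z * divided_diff i (?X * (?X * tail D))"
        unfolding wD tails divided_diff_var_mult[of i "?X * tail D"] by (simp only: pair_weights)
      then show ?thesis
        by (simp add: swap_vars_mult swap_vars_add swap_vars_var mult_ac)
    qed
  qed
  ultimately show ?thesis
    unfolding eq by (simp add: swap_vars_add swap_vars_sum)
qed

text \<open>After the swap \<open>C\<close> lacks \<open>i\<close> instead of \<open>Suc i\<close>,
  so factors at \<open>Suc i\<close> are traded for factors at \<open>i\<close>. Whenever
  \<open>1 + beta * var (Suc i)\<close> meets \<open>var i\<close> under the divided difference, the
  result is the Demazure-Lascoux operator.\<close>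

lemma Phi_one:
  assumes "finite C" "E \<subseteq> C" "i \<in> C" "Suc i \<notin> C"
  shows "Phi (sw i C) (map (sw i) (E # Es)) =
    (1 + beta * var i) * divided_diff i (var i * Phi C (E # Es))"
  unfolding list.map(2) Phi.simps tail_def[symmetric] tail_sw_def[symmetric]
proof (rule sum_dom_le_operator[where Op = "\<lambda>f. (1 + beta * var i) * divided_diff i (var i * f)"])
  show "finite E" by (rule finite_E)
  show "i \<in> E" if "Suc i \<in> E" using ascent that by auto
  show "(1 + beta * var i) * divided_diff i (var i * (f + g)) =
    (1 + beta * var i) * divided_diff i (var i * f) + (1 + beta * var i) * divided_diff i (var i * g)"
    for f g by (simp only: distrib_left divided_diff_add)
  show "(1 + beta * var i) * divided_diff i (var i * 0) = 0" by simp
next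
  let ?y = "1 + beta * var (Suc i)" and ?z = "1 + beta * var i" and ?X = "var i"
    and ?Y = "var (Suc i)"
  have finC: "finite (sw i C)" using assms(1) by simp
  have cC: "cnt (sw i C) (Suc i) = Suc (cnt C (Suc (Suc i)))"
    "cnt (sw i C) (Suc (Suc i)) = cnt C (Suc (Suc i))"
    using cnt_steps[of "sw i C"] assms by (simp_all add: cnt_sw)
  have le: "cnt D i \<le> Suc (cnt C (Suc (Suc i)))" "cnt D (Suc i) \<le> cnt C (Suc (Suc i))"
    if "dom_le D E" for D
    using dom_leD(3)[OF that, of i] dom_leD(3)[OF that, of "Suc i"]
      cnt_mono[OF assms(1,2), of i] cnt_mono[OF assms(1,2), of "Suc i"]
      cnt_steps[OF assms(1)] assms by simp_all
  have scale: "?z * divided_diff i (?X * (c * f)) = c * (?z * divided_diff i (?X * f))"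
    if "swap_vars i c = c" for c f
    using divided_diff_const_mult[OF that, of "?X * f"] by (simp add: mult_ac)
  {
    fix D assume D: "dom_le D E" "i \<notin> D" "Suc i \<notin> D"
    have fin: "finite D" using D(1) by (rule dom_leD)
    let ?d = "cnt D (Suc (Suc i)) < cnt C (Suc (Suc i))"
    have 1: "col_weight C D * col_monom D = far_weight i C D * (if ?d then ?y else 1)"
      using D assms by (simp add: weight_split[OF assms(1) fin, of i])
    have 2: "col_weight (sw i C) D * col_monom D = far_weight i C D * ?z"
      using D assms cC cnt_steps[OF fin] le[OF D(1)] by (simp add: weight_split[OF finC fin, of i])
    have 3: "divided_diff i (?X * ((if ?d then ?y else 1) * tail D)) = tail D"
      by (rule divided_diff_weight_symmetric[OF tail_neither[OF D]])
    show "col_weight (sw i C) D * col_monom D * tail_sw D =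
      ?z * divided_diff i (?X * (col_weight C D * col_monom D * tail D))"
      unfolding 1 2 mult.assoc scale[OF swap_vars_far_weight] 3 tail_sw_eq[OF D(3)] ..
  next
    fix D assume D: "dom_le D E" "i \<in> D" "Suc i \<in> D"
    have fin: "finite D" using D(1) by (rule dom_leD)
    let ?w = "far_weight i C D * (?X * ?Y)"
    have 1: "col_weight C D * col_monom D = ?w * ?y"
      unfolding weight_split[OF assms(1) fin, of i]
      using D assms cnt_steps[OF fin] le[OF D(1)] by (simp add: mult_ac)
    have 2: "col_weight (sw i C) D * col_monom D = ?w * ?z"
      unfolding weight_split[OF finC fin, of i]
      using D assms cC cnt_steps[OF fin] le[OF D(1)] by (simp add: mult_ac)
    have 3: "swap_vars i ?w = ?w"
      by (simp add: swap_vars_mult swap_vars_var mult_ac)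
    show "col_weight (sw i C) D * col_monom D * tail_sw D =
      ?z * divided_diff i (?X * (col_weight C D * col_monom D * tail D))"
      unfolding 1 2 mult.assoc[of ?w] scale[OF 3] divided_diff_weight_mult tail_both[OF D] ..
  next
    fix D assume D: "dom_le D E" "i \<in> D" "Suc i \<notin> D"
    have fin: "finite D" using D(1) by (rule dom_leD)
    have cnt': "cnt (sw i D) (Suc i) = Suc (cnt D (Suc (Suc i)))"
      "cnt (sw i D) (Suc (Suc i)) = cnt D (Suc (Suc i))"
      using cnt_steps[of "sw i D"] fin D by (simp_all add: cnt_sw)
    have finD: "finite (sw i D)" using fin by simp
    let ?d = "cnt D (Suc (Suc i)) < cnt C (Suc (Suc i))" and ?w = "far_weight i C D"
    have 1: "col_weight C D * col_monom D = ?w * ((if ?d then ?y else 1) * ?X)"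
      unfolding weight_split[OF assms(1) fin, of i] using D assms by (simp add: mult_ac)
    have 2: "col_weight (sw i C) D * col_monom D = ?w * (?z * ?X)"
      unfolding weight_split[OF finC fin, of i]
      using D assms cC cnt_steps[OF fin] le[OF D(1)] by (simp add: mult_ac)
    have 3: "col_weight (sw i C) (sw i D) * col_monom (sw i D) =
        ?w * ((if ?d then ?z else 1) * ?Y)"
      unfolding weight_split[OF finC finD, of i]
      using D assms cC cnt' by (simp add: mult_ac)
    have 4: "divided_diff i (?X * ((if ?d then ?y else 1) * (?X * tail D))) =
      ?X * tail D + (if ?d then ?z else 1) * (?Y * divided_diff i (?X * tail D))"
    proof (cases ?d)
      case True
      then show ?thesis
        by (simp only: if_True divided_diff_weight_mult demazure_lascoux_var_mult)
          (simp only: mult_ac)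
    next
      case False
      then show ?thesis
        by (simp only: if_False divided_diff_var_mult[of i "?X * tail D"] mult_1_left)
    qed
    have "?z * divided_diff i (?X * (col_weight C D * col_monom D * tail D)) =
      ?w * (?z * divided_diff i (?X * ((if ?d then ?y else 1) * (?X * tail D))))"
      unfolding 1 mult.assoc by (rule scale) simp
    also have "\<dots> = col_weight (sw i C) D * col_monom D * tail_sw D +
      col_weight (sw i C) (sw i D) * col_monom (sw i D) * tail_sw (sw i D)"
      unfolding 2 3 4 tail_one[OF D] tail_sw_eq[OF D(3)]
      by (simp only: distrib_left mult_ac)
    finally show "col_weight (sw i C) D * col_monom D * tail_sw D +
      col_weight (sw i C) (sw i D) * col_monom (sw i D) * tail_sw (sw i D) =
      ?z * divided_diff i (?X * (col_weight C D * col_monom D * tail D))" by simp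
  next
    fix D assume D: "dom_le D E" "i \<notin> D" "Suc i \<in> D"
    have fin: "finite D" using D(1) by (rule dom_leD)
    obtain h where h: "swap_vars i h = h" "tail D = ?z * h"
      using tail_other[OF D] .
    have "col_weight C D * col_monom D = far_weight i C D * (?y * ?Y)"
      unfolding weight_split[OF assms(1) fin, of i]
      using D assms cnt_steps[OF fin] le[OF D(1)] by (simp add: mult_ac)
    \<comment> \<open>Together with \<open>var i\<close> and the factor of the tail, the weights
      contain all four factors at the two letters, whose product is symmetric.\<close>
    then have "divided_diff i (?X * (col_weight C D * col_monom D * tail D)) = 0"
      using h by (intro divided_diff_symmetric)
        (simp add: swap_vars_mult swap_vars_add swap_vars_var mult_ac)
    then show "?z * divided_diff i (?X * (col_weight C D * col_monom D * tail D)) = 0"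
      by simp
  }
qed

end

lemma weight_empty:
  assumes "finite C"
  shows "col_weight C {} = far_weight i C {} *
    (if Suc i \<notin> C \<and> 0 < cnt C (Suc (Suc i)) then 1 + beta * var (Suc i) else 1) *
    (if i \<notin> C \<and> 0 < cnt C (Suc i) then 1 + beta * var i else 1)"
  using weight_split[OF assms finite.emptyI, of i] by (simp add: col_monom_def cnt_def)

text \<open>The three statements are proved simultaneously, since the column following
  \<open>C\<close> may contain any of the two letters. The induction is on the length because the
  recursion passes to the bounds \<open>cap D F\<close> and not to a sublist.\<close>

lemma Phi_swap:
  "(chain_below C Es \<longrightarrow> i \<in> C \<longrightarrow> Suc i \<in> C \<longrightarrow> (\<forall>F\<in>set Es. Suc i \<in> F \<longrightarrow> i \<in> F) \<longrightarrow>
      Phi C (map (sw i) Es) = demazure_lascoux i (Phi C Es)) \<and>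
   (chain_below C Es \<longrightarrow> i \<notin> C \<longrightarrow> Suc i \<notin> C \<longrightarrow> swap_vars i (Phi C Es) = Phi C Es) \<and>
   (chain_below C Es \<longrightarrow> i \<in> C \<longrightarrow> Suc i \<notin> C \<longrightarrow>
      Phi (sw i C) (map (sw i) Es) = (1 + beta * var i) * divided_diff i (var i * Phi C Es))"
proof (induction Es arbitrary: C rule: length_induct)
  case (1 Es)
  show ?case
  proof (cases Es)
    case Nil
    have "demazure_lascoux i (col_weight C {}) = col_weight C {}"
      if "finite C" "i \<in> C" "Suc i \<in> C"
      using that by (intro demazure_lascoux_symmetric) (simp add: weight_empty[of C i])
    moreover have "swap_vars i (col_weight C {}) = col_weight C {}"
      if "finite C" "i \<notin> C" "Suc i \<notin> C"
      using that cnt_step[of C "Suc i"]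
      by (simp add: weight_empty[of C i] swap_vars_mult swap_vars_add swap_vars_var mult_ac)
    moreover have "col_weight (sw i C) {} =
        (1 + beta * var i) * divided_diff i (var i * col_weight C {})"
      if C: "finite C" "i \<in> C" "Suc i \<notin> C"
    proof -
      have "0 < cnt (sw i C) (Suc i)" using C by (intro cnt_pos[of _ "Suc i"]) auto
      then have 1: "col_weight (sw i C) {} = (1 + beta * var i) * far_weight i C {}"
        using C weight_empty[of "sw i C" i] by (simp add: cnt_sw mult_ac)
      have 2: "var i * col_weight C {} = far_weight i C {} * (var i *
          ((if 0 < cnt C (Suc (Suc i)) then 1 + beta * var (Suc i) else 1) * 1))"
        using C weight_empty[of C i] by (simp add: mult_ac)
      show ?thesis
        unfolding 1 2 divided_diff_const_mult[OF swap_vars_far_weight]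
          divided_diff_weight_symmetric[OF swap_vars_one] by simp
    qed
    ultimately show ?thesis
      using Nil by (simp add: chain_below_def)
  next
    case (Cons E Fs)
    have step: "swap_step i E Fs" if "chain_below C Es" "\<forall>F\<in>set Es. Suc i \<in> F \<longrightarrow> i \<in> F"
    proof
      show "finite E" "sorted_wrt (\<supseteq>) (E # Fs)"
        using that(1) Cons finite_subset by (auto simp: chain_below_def)
    qed (use that Cons 1 in auto)
    have fin: "finite C" "E \<subseteq> C" if "chain_below C Es"
      using that Cons by (auto simp: chain_below_def)
    \<comment> \<open>Bounds are subsets of \<open>C\<close>, so none of them contains
      \<open>Suc i\<close> here and the ascent condition is automatic.\<close>
    have asc: "\<forall>F\<in>set Es. Suc i \<in> F \<longrightarrow> i \<in> F" if "chain_below C Es" "Suc i \<notin> C"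
      using that by (auto simp: chain_below_def)
    show ?thesis
      using swap_step.Phi_both[OF step] swap_step.Phi_neither[OF step]
        swap_step.Phi_one[OF step] fin asc Cons by metis
  qed
qed

subsection \<open>The adjoint of the left key operation\<close>

text \<open>A finite down-closed set of natural numbers is an initial interval.\<close>

lemma less_card_iff_mem:
  assumes "finite (S :: nat set)" "\<And>x y. x \<in> S \<Longrightarrow> y \<le> x \<Longrightarrow> y \<in> S"
  shows "x < card S \<longleftrightarrow> x \<in> S"
proof -
  have "S = {..<card S}"
  proof (rule card_subset_eq[symmetric])
    show "{..<card S} \<subseteq> S"
    proof
      fix x assume "x \<in> {..<card S}"
      show "x \<in> S"
      proof (rule ccontr)
        assume "x \<notin> S"
        then have "S \<subseteq> {..<x}" using assms(2) by (meson lessThan_iff not_less subsetI)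
        then have "card S \<le> x" using card_mono[of "{..<x}" S] by simp
        with \<open>x \<in> {..<card S}\<close> show False by simp
      qed
    qed
  qed (use assms(1) in auto)
  then show ?thesis by (metis lessThan_iff)
qed

definition below :: "nat set \<Rightarrow> nat \<Rightarrow> nat" where
  "below A k = card {x \<in> A. x < k}"

lemma below_cnt: "finite A \<Longrightarrow> below A k + cnt A k = card A"
  unfolding below_def by (rule card_below)

lemma below_0 [simp]: "below A 0 = 0"
  by (simp add: below_def)

lemma below_Suc: "finite A \<Longrightarrow> below A (Suc k) = below A k + of_bool (k \<in> A)"
  using below_cnt[of A k] below_cnt[of A "Suc k"] cnt_step[of A k] by linarith

lemma nth_less_iff:
  assumes "finite A" "r < card A"
  shows "sorted_list_of_set A ! r < k \<longleftrightarrow> r < below A k"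
proof -
  let ?l = "sorted_list_of_set A" and ?S = "{r. r < card A \<and> sorted_list_of_set A ! r < k}"
  have len: "length ?l = card A" by simp
  have "below A k = card ?S"
  proof -
    have "{x \<in> A. x < k} = {x \<in> set ?l. x < k}" using assms(1) by simp
    also have "\<dots> = (\<lambda>r. ?l ! r) ` ?S" unfolding set_conv_nth len by blast
    finally have "{x \<in> A. x < k} = (\<lambda>r. ?l ! r) ` ?S" .
    moreover have "inj_on (\<lambda>r. ?l ! r) ?S"
      using inj_on_nth[OF distinct_sorted_list_of_set, of ?S A] len by simp
    ultimately show ?thesis by (simp add: below_def card_image)
  qed
  moreover have "r < card ?S \<longleftrightarrow> r \<in> ?S"
  proof (rule less_card_iff_mem)
    fix x y assume "x \<in> ?S" "y \<le> x"
    moreover from this have "?l ! y \<le> ?l ! x"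
      using sorted_sorted_list_of_set[of A] len by (intro sorted_nth_mono) auto
    ultimately show "y \<in> ?S" by auto
  qed simp
  ultimately show ?thesis using assms(2) by simp
qed

text \<open>This connects the counting form with the entrywise comparison in \<open>key_le\<close>;
  by \<open>nth_less_iff\<close>, ranks and counts determine each other.\<close>

lemma dom_le_iff_nth:
  assumes "finite E"
  shows "dom_le A E \<longleftrightarrow> finite A \<and> card A = card E \<and>
    (\<forall>r<card A. sorted_list_of_set A ! r \<le> sorted_list_of_set E ! r)"
proof -
  have "(\<forall>k. cnt A k \<le> cnt E k) \<longleftrightarrow>
    (\<forall>r<card A. sorted_list_of_set A ! r \<le> sorted_list_of_set E ! r)"
    if A: "finite A" "card A = card E"
  proof -
    have "cnt A k \<le> cnt E k \<longleftrightarrow> below E k \<le> below A k" for k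
      using below_cnt[OF assms, of k] below_cnt[OF A(1), of k] A(2) by linarith
    moreover have "(\<forall>k. below E k \<le> below A k) \<longleftrightarrow>
      (\<forall>r<card A. sorted_list_of_set A ! r \<le> sorted_list_of_set E ! r)"
    proof (intro iffI allI impI)
      fix r assume le: "\<forall>k. below E k \<le> below A k" and r: "r < card A"
      show "sorted_list_of_set A ! r \<le> sorted_list_of_set E ! r"
        using nth_less_iff[OF assms, of r "Suc (sorted_list_of_set E ! r)"]
          nth_less_iff[OF A(1) r, of "Suc (sorted_list_of_set E ! r)"] r A(2)
          le[rule_format, of "Suc (sorted_list_of_set E ! r)"] by simp
    next
      fix k assume le: "\<forall>r<card A. sorted_list_of_set A ! r \<le> sorted_list_of_set E ! r"
      show "below E k \<le> below A k"
      proof (rule ccontr)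
        assume "\<not> below E k \<le> below A k"
        \<comment> \<open>The rank that violates the comparison is \<open>below A k\<close>: the
          element of this rank is below \<open>k\<close> in \<open>E\<close> but not in
          \<open>A\<close>.\<close>
        then have less: "below A k < below E k" by simp
        then have r: "below A k < card A"
          using below_cnt[OF assms, of k] A(2) by linarith
        have "sorted_list_of_set E ! below A k < k"
          using nth_less_iff[OF assms, of "below A k" k] less r A(2) by simp
        moreover have "\<not> sorted_list_of_set A ! below A k < k"
          using nth_less_iff[OF A(1) r, of k] by simp
        ultimately show False using le r by fastforce
      qed
    qed
    ultimately show ?thesis by simp
  qed
  then show ?thesis unfolding dom_le_def by blast
qed

text \<open>The same queue with \<open>A\<close> and \<open>D\<close> scanned upwards describes \<open>D \<triangleleft> A\<close>.\<close>

primrec up_queue :: "nat set \<Rightarrow> nat set \<Rightarrow> nat \<Rightarrow> nat" where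
  "up_queue D A 0 = 0"
| "up_queue D A (Suc k) = up_queue D A k + of_bool (k \<in> A) - of_bool (k \<in> D)"

definition up_cap :: "nat set \<Rightarrow> nat set \<Rightarrow> nat set" where
  "up_cap D A = {k \<in> D. k \<in> A \<or> 0 < up_queue D A k}"

lemma up_cap_subset: "up_cap D A \<subseteq> D"
  by (auto simp: up_cap_def)

lemma below_up_cap:
  assumes "finite D" "finite A"
  shows "below (up_cap D A) k + up_queue D A k = below A k"
proof (induction k)
  case (Suc k)
  have "finite (up_cap D A)" using assms(1) up_cap_subset finite_subset by blast
  with Suc show ?case
    using below_Suc[OF assms(2), of k] below_Suc[of "up_cap D A" k]
    by (auto simp: up_cap_def of_bool_def split: if_splits)
qed simp

lemma up_cap_mono:
  assumes "A \<subseteq> B"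
  shows "up_cap D A \<subseteq> up_cap D B"
proof -
  have le: "up_queue D A k \<le> up_queue D B k" for k
  proof (induction k)
    case (Suc k)
    have "of_bool (k \<in> A) \<le> (of_bool (k \<in> B) :: nat)" using assms by auto
    with Suc show ?case unfolding up_queue.simps by linarith
  qed simp
  show ?thesis
  proof
    fix x assume "x \<in> up_cap D A"
    then show "x \<in> up_cap D B" using le[of x] assms by (auto simp: up_cap_def)
  qed
qed

text \<open>Upward mirror image of \<open>cap_dom_le\<close>: if elements of \<open>A\<close> were
  left waiting at the end, the queue would be nonempty at every earlier position, even at 0. Hence
  each is served at or above its own position.\<close>

lemma dom_le_up_cap:
  assumes "finite D" "finite A" "\<And>k. cnt A k \<le> cnt D k"
  shows "dom_le A (up_cap D A)"
proof -
  have finU: "finite (up_cap D A)" using assms(1) up_cap_subset finite_subset by blast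
  obtain N where N: "\<And>x. x \<in> D \<Longrightarrow> x < N" "\<And>x. x \<in> A \<Longrightarrow> x < N"
    using finite_bounded[OF assms(1,2)] by metis
  have D0: "cnt D N = 0" by (rule cnt_eq_0) (erule N(1))
  have A0: "cnt A N = 0" by (rule cnt_eq_0) (erule N(2))
  have U0: "cnt (up_cap D A) N = 0"
    by (rule cnt_eq_0) (rule N(1), erule up_cap_subset[THEN subsetD])
  have "up_queue D A N = 0"
  proof (rule ccontr)
    assume "up_queue D A N \<noteq> 0"
    then have pos: "0 < up_queue D A N" by simp
    have le: "up_queue D A N + cnt D k \<le> up_queue D A k + cnt A k" if "k \<le> N" for k
      using that
    proof (induction rule: inc_induct)
      case base
      show ?case unfolding D0 A0 by simp
    next
      case (step k)
      have "0 < up_queue D A (Suc k)"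
        using step.IH pos assms(3)[of "Suc k"] by linarith
      then have "up_queue D A (Suc k) + of_bool (k \<in> D) = up_queue D A k + of_bool (k \<in> A)"
        unfolding up_queue.simps by linarith
      then show ?case
        using step.IH cnt_step[OF assms(1), of k] cnt_step[OF assms(2), of k] by linarith
    qed
    have "up_queue D A N + cnt D 0 \<le> cnt A 0" using le[OF le0] unfolding up_queue.simps by linarith
    with pos assms(3)[of 0] show False by linarith
  qed
  then have "below (up_cap D A) N = below A N" using below_up_cap[OF assms(1,2), of N] by linarith
  then have card: "card (up_cap D A) = card A"
    using below_cnt[OF assms(2), of N] below_cnt[OF finU, of N] A0 U0 by linarith
  have "cnt A k \<le> cnt (up_cap D A) k" for k
    using below_up_cap[OF assms(1,2), of k] below_cnt[OF assms(2), of k] below_cnt[OF finU, of k] card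
    by linarith
  then show ?thesis unfolding dom_le_def using card assms(2) by metis
qed

text \<open>Mirror image of \<open>cap_maximal\<close>: at an element of \<open>B\<close> outside
  \<open>up_cap D A\<close> the queue is empty, so the counts of \<open>A\<close> and
  \<open>up_cap D A\<close> below the next position agree.\<close>

lemma up_cap_minimal:
  assumes "finite D" "finite A" "\<And>k. cnt A k \<le> cnt D k" "B \<subseteq> D" "dom_le A B"
  shows "dom_le (up_cap D A) B"
proof -
  have finU: "finite (up_cap D A)" using assms(1) up_cap_subset finite_subset by blast
  have finB: "finite B" using assms(1,4) finite_subset by blast
  have card: "card (up_cap D A) = card B"
    using dom_leD(2)[OF dom_le_up_cap[OF assms(1-3)]] dom_leD(2)[OF assms(5)] by simp
  have BA: "below B k \<le> below A k" for k
    using dom_leD(3)[OF assms(5), of k] dom_leD(2)[OF assms(5)] below_cnt[OF finB, of k]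
      below_cnt[OF assms(2), of k] by linarith
  have "below B k \<le> below (up_cap D A) k" for k
  proof (induction k)
    case (Suc k)
    show ?case
    proof (cases "k \<in> B \<and> k \<notin> up_cap D A")
      case True
      then have "k \<notin> A" "up_queue D A k = 0" using assms(4) by (auto simp: up_cap_def)
      then have "up_queue D A (Suc k) = 0" by simp
      then show ?thesis using BA[of "Suc k"] below_up_cap[OF assms(1,2), of "Suc k"] by simp
    next
      case False
      with Suc show ?thesis
        by (auto simp: below_Suc[OF finB] below_Suc[OF finU])
    qed
  qed simp
  then have le: "below B k \<le> below (up_cap D A) k" for k .
  have "cnt (up_cap D A) k \<le> cnt B k" for k
    using below_cnt[OF finB, of k] below_cnt[OF finU, of k] card le[of k] by linarith
  with finU card show ?thesis by (simp add: dom_le_def)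
qed

lemma tri_eq_up_cap:
  assumes "finite D" "finite A" "\<And>k. cnt A k \<le> cnt D k"
  shows "D \<triangleleft> A = up_cap D A"
proof -
  let ?U = "up_cap D A"
  have finU: "finite ?U" using assms(1) up_cap_subset finite_subset by blast
  note dom = dom_le_up_cap[OF assms]
  have card: "card A = card ?U" using dom by (rule dom_leD)
  let ?a = "\<lambda>r. sorted_list_of_set A ! r" and ?u = "\<lambda>r. sorted_list_of_set ?U ! r"
  have a_le_u: "?a r \<le> ?u r" if "r < card A" for r
    using dom that unfolding dom_le_iff_nth[OF finU] by blast
  have u_mem: "?u r \<in> ?U" if "r < card A" for r
    using that card finU by (metis length_sorted_list_of_set nth_mem set_sorted_list_of_set)
  have u_less: "?u r < ?u s" if "r < s" "s < card A" for r s
    using sorted_wrt_nth_less[OF strict_sorted_list_of_set[of ?U] that(1)] that(2) card by simp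
  \<comment> \<open>No smaller candidate exists. An element \<open>y\<close> of \<open>D\<close>
    contradicting this would lie outside \<open>up_cap D A\<close> and be idle, so all elements of
    \<open>A\<close> below it would be served; but \<open>A\<close> has more than \<open>r\<close>
    elements below \<open>y\<close>, and \<open>up_cap D A\<close> only \<open>r\<close>.\<close>
  have gap: "?u r \<le> y" if r: "r < card A" and y: "y \<in> D" "?a r \<le> y"
    "\<And>s. r = Suc s \<Longrightarrow> ?u s < y" for r y
  proof (rule ccontr)
    assume "\<not> ?u r \<le> y"
    then have less: "y < ?u r" by simp
    have b: "below ?U y = r"
    proof -
      have "\<not> r < below ?U y" using nth_less_iff[OF finU, of r y] r card less by simp
      moreover have "s < below ?U y" if "r = Suc s" for s
        using nth_less_iff[OF finU, of s y] r card y(3)[OF that] that by simp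
      ultimately show ?thesis by (cases r) (auto simp: not_less Suc_le_eq intro: le_antisym)
    qed
    have "y \<notin> ?U"
    proof
      assume "y \<in> ?U"
      then have "below ?U (Suc y) = Suc r" using below_Suc[OF finU, of y] b by simp
      then have "?u r < Suc y" using nth_less_iff[OF finU, of r "Suc y"] r card by simp
      with less show False by simp
    qed
    then have "y \<notin> A" "up_queue D A y = 0" using y(1) by (auto simp: up_cap_def)
    moreover have "?a r \<noteq> y"
      using \<open>y \<notin> A\<close> r assms(2) by (metis length_sorted_list_of_set nth_mem set_sorted_list_of_set)
    ultimately have "r < below A y"
      using nth_less_iff[OF assms(2) r, of y] y(2) by simp
    then show False using below_up_cap[OF assms(1,2), of y] b \<open>up_queue D A y = 0\<close> by simp
  qed
  have elem: "tri_elem D A r = ?u r" if "r < card A" for r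
    using that
  proof (induction r)
    case 0
    show ?case unfolding tri_elem.simps
    proof (rule Least_equality)
      show "?u 0 \<in> D \<and> ?a 0 \<le> ?u 0"
        using a_le_u[OF 0] u_mem[OF 0] up_cap_subset by blast
    qed (use gap[OF 0] in auto)
  next
    case (Suc r)
    have IH: "tri_elem D A r = ?u r" using Suc by simp
    show ?case unfolding tri_elem.simps IH
    proof (rule Least_equality)
      show "?u (Suc r) \<in> D \<and> ?a (Suc r) \<le> ?u (Suc r) \<and> ?u r < ?u (Suc r)"
        using a_le_u[OF Suc.prems] u_mem[OF Suc.prems] u_less[OF _ Suc.prems, of r] up_cap_subset
        by blast
    qed (use gap[OF Suc.prems] in auto)
  qed
  have "D \<triangleleft> A = ?u ` {..<card A}" unfolding tri_def using elem by (intro image_cong) auto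
  also have "\<dots> = set (sorted_list_of_set ?U)"
    using card by (auto simp: set_conv_nth)
  finally show ?thesis using finU by simp
qed

text \<open>\<open>up_cap D A\<close> is the least subset of \<open>D\<close> above
  \<open>A\<close>, and \<open>cap D E\<close> is the greatest subset of \<open>D\<close> below
  \<open>E\<close>. So both sides express that some subset of \<open>D\<close> lies between
  \<open>A\<close> and \<open>E\<close>.\<close>

lemma dom_le_tri_iff:
  assumes "finite D" "finite A" "\<And>k. cnt A k \<le> cnt D k" "finite E" "dom_le (cap D E) E"
  shows "dom_le (D \<triangleleft> A) E \<longleftrightarrow> dom_le A (cap D E)"
  unfolding tri_eq_up_cap[OF assms(1-3)]
proof
  assume le: "dom_le (up_cap D A) E"
  have "cnt (up_cap D A) k \<le> cnt (cap D E) k" for k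
    using dom_leD(3)[OF le] by (intro cap_maximal assms up_cap_subset)
  then have "dom_le (up_cap D A) (cap D E)"
    using dom_leD(1,2)[OF le] dom_leD(2)[OF assms(5)] by (simp add: dom_le_def)
  with dom_le_up_cap[OF assms(1-3)] show "dom_le A (cap D E)" by (rule dom_le_trans)
next
  assume "dom_le A (cap D E)"
  with up_cap_minimal[OF assms(1-3) cap_subset] assms(5)
  show "dom_le (up_cap D A) E" using dom_le_trans by blast
qed

section \<open>Iterated left keys of lists of columns\<close>

definition descending :: "nat set list \<Rightarrow> bool" where
  "descending Cs \<longleftrightarrow> (\<forall>C\<in>set Cs. finite C) \<and> successively (\<lambda>C D. \<forall>k. cnt D k \<le> cnt C k) Cs"

lemma descending_Cons:
  "descending (C # Cs) \<longleftrightarrow>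
    finite C \<and> descending Cs \<and> (Cs \<noteq> [] \<longrightarrow> (\<forall>k. cnt (hd Cs) k \<le> cnt C k))"
  by (cases Cs) (auto simp: descending_def)

lemma descending_Nil [simp]: "descending []"
  by (simp add: descending_def)

lemma tri_list_Cons: "Cs \<noteq> [] \<Longrightarrow> tri_list (C # Cs) = C \<triangleleft> tri_list Cs"
  by (cases Cs) auto

lemma tri_list_props:
  assumes "descending Cs" "Cs \<noteq> []"
  shows "tri_list Cs \<subseteq> hd Cs \<and> card (tri_list Cs) = card (last Cs)"
  using assms
proof (induction Cs)
  case (Cons C Cs)
  show ?case
  proof (cases "Cs = []")
    case False
    then have IH: "tri_list Cs \<subseteq> hd Cs" "card (tri_list Cs) = card (last Cs)"
      using Cons by (auto simp: descending_Cons)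
    have fin: "finite (hd Cs)" "finite C"
      using Cons.prems False by (auto simp: descending_def)
    have le: "cnt (tri_list Cs) k \<le> cnt C k" for k
      using cnt_mono[OF fin(1) IH(1), of k] Cons.prems False
      by (auto simp: descending_Cons intro: order_trans)
    have "finite (tri_list Cs)" using IH(1) fin(1) by (rule finite_subset)
    note tri = tri_eq_up_cap[OF fin(2) this le] dom_le_up_cap[OF fin(2) this le]
    then show ?thesis
      using False IH(2) up_cap_subset[of C] dom_leD(2)[OF tri(2)] by (simp add: tri_list_Cons)
  qed simp
qed simp

lemma tri_list_cnt:
  assumes "descending (C # Cs)" "Cs \<noteq> []"
  shows "finite (tri_list Cs)" "cnt (tri_list Cs) k \<le> cnt C k"
proof -
  have desc: "descending Cs" using assms(1) by (simp add: descending_Cons)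
  have sub: "tri_list Cs \<subseteq> hd Cs" "finite (hd Cs)"
    using desc assms(2) tri_list_props[OF desc] by (simp_all add: descending_def)
  then show "finite (tri_list Cs)" using finite_subset by blast
  show "cnt (tri_list Cs) k \<le> cnt C k"
    using cnt_mono[OF sub(2,1), of k] assms by (auto simp: descending_Cons intro: order_trans)
qed

lemma descending_take: "descending Cs \<Longrightarrow> descending (take n Cs)"
proof (induction Cs arbitrary: n)
  case (Cons C Cs)
  then show ?case by (cases n; cases "take (n - 1) Cs = []") (auto simp: descending_Cons hd_take)
qed simp

text \<open>Monotonicity of \<open>up_cap\<close>, propagated to the left from the last column. It
  makes the columns of the left key nested.\<close>

lemma tri_list_append_subset:
  assumes "descending (Cs @ [F])" "Cs \<noteq> []"
  shows "tri_list (Cs @ [F]) \<subseteq> tri_list Cs"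
  using assms
proof (induction Cs)
  case (Cons C Cs)
  have desc: "descending (C # Cs)"
    using descending_take[OF Cons.prems(1), of "length (C # Cs)"] by simp
  have fin: "finite C" using desc by (simp add: descending_Cons)
  show ?case
  proof (cases "Cs = []")
    case True
    then have "C \<triangleleft> F = up_cap C F"
      using Cons.prems by (intro tri_eq_up_cap) (auto simp: descending_Cons descending_def)
    with True show ?thesis using up_cap_subset by simp
  next
    case False
    have "tri_list (Cs @ [F]) \<subseteq> tri_list Cs"
      using Cons False by (simp add: descending_Cons)
    moreover have "C \<triangleleft> tri_list (Cs @ [F]) = up_cap C (tri_list (Cs @ [F]))"
      using tri_list_cnt[of C "Cs @ [F]"] Cons.prems fin by (intro tri_eq_up_cap) auto
    moreover have "C \<triangleleft> tri_list Cs = up_cap C (tri_list Cs)"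
      using tri_list_cnt[OF desc False] fin by (intro tri_eq_up_cap) auto
    ultimately show ?thesis
      using False up_cap_mono by (simp add: tri_list_Cons)
  qed
qed simp

text \<open>These are the lists of columns over which the nested sums in \<open>Phi\<close> run;
  \<open>list_weight\<close> is the corresponding summand.\<close>

fun admissible :: "nat set list \<Rightarrow> nat set list \<Rightarrow> bool" where
  "admissible [] Ds \<longleftrightarrow> Ds = []"
| "admissible (E # Es) [] \<longleftrightarrow> False"
| "admissible (E # Es) (D # Ds) \<longleftrightarrow> dom_le D E \<and> admissible (map (cap D) Es) Ds"

fun list_weight :: "nat set \<Rightarrow> nat set list \<Rightarrow> beta_mpoly" where
  "list_weight C [] = col_weight C {}"
| "list_weight C (D # Ds) = col_weight C D * col_monom D * list_weight D Ds"

lemma admissible_length: "admissible Es Ds \<Longrightarrow> length Ds = length Es"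
  by (induction Es Ds rule: admissible.induct) auto

lemma Phi_eq_sum:
  assumes "\<forall>E\<in>set Es. finite E"
  shows "finite {Ds. admissible Es Ds}" "Phi C Es = (\<Sum>Ds | admissible Es Ds. list_weight C Ds)"
proof -
  have "finite {Ds. admissible Es Ds} \<and> Phi C Es = (\<Sum>Ds | admissible Es Ds. list_weight C Ds)"
    using assms
  proof (induction C Es rule: Phi.induct)
    case (1 C)
    have eq: "{Ds. admissible [] Ds} = {[]}" by auto
    show ?case unfolding eq by simp
  next
    case (2 C E Es)
    let ?A = "\<lambda>D. {Ds. admissible (map (cap D) Es) Ds}"
    have finD: "finite {D. dom_le D E}" using 2 by (simp add: finite_dom_le)
    have IH: "finite (?A D)" "Phi D (map (cap D) Es) = (\<Sum>Ds\<in>?A D. list_weight D Ds)"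
      if "dom_le D E" for D
      using 2 that finD finite_cap[OF dom_leD(1)[OF that]] by auto
    have eq: "{Ds. admissible (E # Es) Ds} = (\<lambda>(D, Ds). D # Ds) ` (SIGMA D:{D. dom_le D E}. ?A D)"
    proof (intro equalityI subsetI)
      fix Ds assume "Ds \<in> {Ds. admissible (E # Es) Ds}"
      then show "Ds \<in> (\<lambda>(D, Ds). D # Ds) ` (SIGMA D:{D. dom_le D E}. ?A D)"
        by (cases Ds) auto
    qed auto
    have "finite {Ds. admissible (E # Es) Ds}"
      unfolding eq using finD IH(1) by (intro finite_imageI finite_SigmaI) auto
    moreover have "(\<Sum>Ds | admissible (E # Es) Ds. list_weight C Ds) =
      (\<Sum>(D, Ds)\<in>(SIGMA D:{D. dom_le D E}. ?A D). list_weight C (D # Ds))"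
      unfolding eq by (subst sum.reindex) (auto simp: inj_on_def case_prod_beta)
    moreover have "\<dots> = (\<Sum>D | dom_le D E. \<Sum>Ds\<in>?A D. list_weight C (D # Ds))"
      using finD IH(1) by (subst sum.Sigma) auto
    moreover have "\<dots> = Phi C (E # Es)"
      using IH(2) by (simp add: sum_distrib_left mult.assoc)
    ultimately show ?case by simp
  qed
  then show "finite {Ds. admissible Es Ds}"
    "Phi C Es = (\<Sum>Ds | admissible Es Ds. list_weight C Ds)" by auto
qed

text \<open>The first column is peeled off by the adjunction \<open>dom_le_tri_iff\<close>: a bound
  \<open>F\<close> on a key column starting with \<open>D\<close> becomes the bound
  \<open>cap D F\<close> on the key column without \<open>D\<close>. Admissible columns descend
  because each is dominated by a subset of its predecessor.\<close>

lemma admissible_iff: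
  assumes "sorted_wrt (\<supseteq>) Es" "\<forall>E\<in>set Es. finite E"
  shows "admissible Es Ds \<longleftrightarrow> length Ds = length Es \<and> descending Ds \<and>
    (\<forall>c<length Es. dom_le (tri_list (take (Suc c) Ds)) (Es ! c))"
  using assms
proof (induction Es Ds rule: admissible.induct)
  case (1 Ds)
  then show ?case by (auto simp: descending_def)
next
  case (2 E Es)
  then show ?case by simp
next
  case (3 E Es D Ds)
  show ?case
  proof (cases "dom_le D E")
    case False
    then show ?thesis by auto
  next
    case dom: True
    have finD: "finite D" using dom by (rule dom_leD)
    \<comment> \<open>The adjunction requires \<open>cap D F\<close> to have the size of
      \<open>F\<close>; this holds because \<open>F\<close> is contained in \<open>E\<close> and
      \<open>D\<close> is below \<open>E\<close>.\<close>
    have full: "dom_le (cap D F) F" if "F \<in> set Es" for F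
      using that 3(2,3) dom by (intro cap_dom_le'[of D E]) auto
    have "sorted_wrt (\<supseteq>) (map (cap D) Es)"
      using chain_below_cap[OF finD, of Es] 3(2,3) by (simp add: chain_below_def)
    then have IH: "admissible (map (cap D) Es) Ds \<longleftrightarrow> length Ds = length Es \<and> descending Ds \<and>
      (\<forall>c<length Es. dom_le (tri_list (take (Suc c) Ds)) (cap D (Es ! c)))"
      using 3(1) finite_cap[OF finD] by simp
    have hd: "cnt (hd Ds) k \<le> cnt D k"
      if adm: "admissible (map (cap D) Es) Ds" "Ds \<noteq> []" for k
    proof -
      obtain E' Es' D' Ds' where eq: "Es = E' # Es'" "Ds = D' # Ds'"
        using adm admissible_length[OF adm(1)] by (cases Es; cases Ds) auto
      then have "dom_le D' (cap D E')" using adm by simp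
      then have "cnt D' k \<le> cnt (cap D E') k" by (rule dom_leD)
      also have "\<dots> \<le> cnt D k" by (rule cnt_mono[OF finD cap_subset])
      finally show ?thesis using eq by simp
    qed
    have desc: "descending (D # Ds)" if adm: "admissible (map (cap D) Es) Ds"
      using hd[OF adm] finD adm IH by (simp add: descending_Cons)
    have key: "dom_le (tri_list (take (Suc (Suc c)) (D # Ds))) (Es ! c) \<longleftrightarrow>
        dom_le (tri_list (take (Suc c) Ds)) (cap D (Es ! c))"
      if d: "descending (D # Ds)" and c: "c < length Es" and len: "length Ds = length Es" for c
    proof -
      have ne: "take (Suc c) Ds \<noteq> []" using c len by auto
      have "descending (D # take (Suc c) Ds)"
        using descending_take[OF d, of "Suc (Suc c)"] by simp
      note tri_list_cnt[OF this ne]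
      then have "dom_le (D \<triangleleft> tri_list (take (Suc c) Ds)) (Es ! c) \<longleftrightarrow>
        dom_le (tri_list (take (Suc c) Ds)) (cap D (Es ! c))"
        using c 3(3) full finD by (intro dom_le_tri_iff) auto
      then show ?thesis using ne by (simp add: tri_list_Cons)
    qed
    have all: "(\<forall>c<length (E # Es). dom_le (tri_list (take (Suc c) (D # Ds))) ((E # Es) ! c)) \<longleftrightarrow>
      (\<forall>c<length Es. dom_le (tri_list (take (Suc (Suc c)) (D # Ds))) (Es ! c))"
      using dom by (simp add: All_less_Suc2)
    show ?thesis
    proof
      assume "admissible (E # Es) (D # Ds)"
      then have adm: "admissible (map (cap D) Es) Ds" by simp
      then show "length (D # Ds) = length (E # Es) \<and> descending (D # Ds) \<and>
        (\<forall>c<length (E # Es). dom_le (tri_list (take (Suc c) (D # Ds))) ((E # Es) ! c))"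
        unfolding all using IH desc[OF adm] key by simp
    next
      assume rhs: "length (D # Ds) = length (E # Es) \<and> descending (D # Ds) \<and>
        (\<forall>c<length (E # Es). dom_le (tri_list (take (Suc c) (D # Ds))) ((E # Es) ! c))"
      then have "admissible (map (cap D) Es) Ds"
        unfolding all IH using key by (simp add: descending_Cons)
      with dom show "admissible (E # Es) (D # Ds)" by simp
    qed
  qed
qed

subsection \<open>Tableaux as lists of columns\<close>

text \<open>The column lengths of the shape, that is, the conjugate partition. The shift arises
  because boxes number columns from 0 and \<open>key_column\<close> from 1.\<close>

definition height :: "composition \<Rightarrow> nat \<Rightarrow> nat" where
  "height \<alpha> c = card (key_column \<alpha> (Suc c))"

lemma finite_key_column: "finite (key_column \<alpha> (Suc c))"
  by (rule finite_subset[of _ "Poly_Mapping.keys \<alpha>"]) (auto simp: key_column_def in_keys_iff)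

lemma key_column_antimono: "j \<le> k \<Longrightarrow> key_column \<alpha> k \<subseteq> key_column \<alpha> j"
  by (auto simp: key_column_def)

lemma chain_key_columns:
  "sorted_wrt (\<supseteq>) (map (\<lambda>c. key_column \<alpha> (Suc c)) [0..<n])"
  "\<forall>E\<in>set (map (\<lambda>c. key_column \<alpha> (Suc c)) [0..<n]). finite E"
  by (simp_all add: sorted_wrt_iff_nth_less finite_key_column key_column_antimono)

lemma height_antimono: "c \<le> d \<Longrightarrow> height \<alpha> d \<le> height \<alpha> c"
  unfolding height_def by (intro card_mono finite_key_column key_column_antimono) simp

lemma less_length_filter_iff:
  "sorted_wrt (\<ge>) ys \<Longrightarrow> r < length (filter (\<lambda>v. c < v) ys) \<longleftrightarrow> r < length ys \<and> (c :: nat) < ys ! r"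
proof (induction ys arbitrary: r)
  case (Cons y ys)
  show ?case
  proof (cases "c < y")
    case True
    then show ?thesis using Cons by (cases r) auto
  next
    case False
    then have *: "\<not> c < v" if "v \<in> set (y # ys)" for v using that Cons.prems by auto
    then have "filter (\<lambda>v. c < v) (y # ys) = []" by (auto simp: filter_empty_conv)
    moreover have "\<not> (r < length (y # ys) \<and> c < (y # ys) ! r)" using * nth_mem by blast
    ultimately show ?thesis by simp
  qed
qed simp

text \<open>Sorting preserves the number of parts exceeding \<open>c\<close>, and in a decreasing
  list these parts occupy the first positions.\<close>

lemma less_lookup_sort_comp_iff: "c < Poly_Mapping.lookup (sort_comp \<alpha>) r \<longleftrightarrow> r < height \<alpha> c"
proof -
  define xs where "xs = map (Poly_Mapping.lookup \<alpha>) (sorted_list_of_set (Poly_Mapping.keys \<alpha>))"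
  define ys where "ys = rev (sort xs)"
  have "sorted_wrt (\<ge>) ys" by (simp add: ys_def sorted_wrt_rev)
  note iff = less_length_filter_iff[OF this, of r c]
  have "mset ys = mset xs" by (simp add: ys_def)
  then have "length (filter (\<lambda>v. c < v) ys) = length (filter (\<lambda>v. c < v) xs)"
    by (metis mset_filter size_mset)
  also have "\<dots> = length (filter (\<lambda>i. c < Poly_Mapping.lookup \<alpha> i)
      (sorted_list_of_set (Poly_Mapping.keys \<alpha>)))"
    by (simp add: xs_def filter_map comp_def)
  also have "\<dots> = card {i \<in> Poly_Mapping.keys \<alpha>. c < Poly_Mapping.lookup \<alpha> i}"
    by (subst distinct_length_filter) (auto intro: arg_cong[where f = card])
  also have "{i \<in> Poly_Mapping.keys \<alpha>. c < Poly_Mapping.lookup \<alpha> i} = key_column \<alpha> (Suc c)"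
    by (auto simp: key_column_def in_keys_iff)
  finally have "r < height \<alpha> c \<longleftrightarrow> r < length ys \<and> c < ys ! r"
    using iff by (simp add: height_def)
  moreover have "Poly_Mapping.lookup (sort_comp \<alpha>) r = nth_default 0 ys r"
    unfolding sort_comp_def ys_def xs_def by (simp add: nth.rep_eq)
  ultimately show ?thesis by (auto simp: nth_default_def)
qed

lemma boxes_sort_comp: "boxes (sort_comp \<alpha>) = {(r, c). r < height \<alpha> c}"
  by (simp add: boxes_def less_lookup_sort_comp_iff)

lemma sort_comp_eq_iff: "sort_comp \<alpha> = sort_comp \<gamma> \<longleftrightarrow> (\<forall>c. height \<alpha> c = height \<gamma> c)"
proof
  assume eq: "sort_comp \<alpha> = sort_comp \<gamma>"
  have "r < height \<alpha> c \<longleftrightarrow> r < height \<gamma> c" for r c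
    using less_lookup_sort_comp_iff[of c \<alpha> r] less_lookup_sort_comp_iff[of c \<gamma> r] eq by simp
  then show "\<forall>c. height \<alpha> c = height \<gamma> c" by (metis linorder_neqE_nat less_irrefl)
next
  assume eq: "\<forall>c. height \<alpha> c = height \<gamma> c"
  show "sort_comp \<alpha> = sort_comp \<gamma>"
  proof (rule poly_mapping_eqI)
    fix r
    have "c < Poly_Mapping.lookup (sort_comp \<alpha>) r \<longleftrightarrow> c < Poly_Mapping.lookup (sort_comp \<gamma>) r" for c
      using less_lookup_sort_comp_iff[of c \<alpha> r] less_lookup_sort_comp_iff[of c \<gamma> r] eq by simp
    then show "Poly_Mapping.lookup (sort_comp \<alpha>) r = Poly_Mapping.lookup (sort_comp \<gamma>) r"
      by (metis linorder_neqE_nat less_irrefl)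
  qed
qed

definition width :: "composition \<Rightarrow> nat" where
  "width \<alpha> = Poly_Mapping.lookup (sort_comp \<alpha>) 0"

lemma less_width_iff: "c < width \<alpha> \<longleftrightarrow> 0 < height \<alpha> c"
  by (simp add: width_def less_lookup_sort_comp_iff)

lemma finite_boxes: "finite (boxes (sort_comp \<alpha>))"
proof (rule finite_subset)
  show "boxes (sort_comp \<alpha>) \<subseteq> {..<height \<alpha> 0} \<times> {..<width \<alpha>}"
  proof
    fix s assume "s \<in> boxes (sort_comp \<alpha>)"
    then obtain r c where "s = (r, c)" "r < height \<alpha> c" by (auto simp: boxes_sort_comp)
    then show "s \<in> {..<height \<alpha> 0} \<times> {..<width \<alpha>}"
      using height_antimono[of 0 c \<alpha>] by (simp add: less_width_iff)
  qed
qed simp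

lemma boxes_Sigma: "boxes (sort_comp \<alpha>) = prod.swap ` (SIGMA c:{..<width \<alpha>}. {..<height \<alpha> c})"
  by (force simp: boxes_sort_comp less_width_iff)

lemma prod_boxes:
  "(\<Prod>s\<in>boxes (sort_comp \<alpha>). f s) = (\<Prod>c<width \<alpha>. \<Prod>r<height \<alpha> c. f (r, c))"
  unfolding boxes_Sigma by (subst prod.reindex) (auto simp: prod.Sigma case_prod_beta prod.swap_def)

definition nth_largest :: "nat set \<Rightarrow> nat \<Rightarrow> nat" where
  "nth_largest A r = rev (sorted_list_of_set A) ! r"

lemma le_nth_largest_iff:
  assumes "finite A" "r < card A"
  shows "k \<le> nth_largest A r \<longleftrightarrow> r < cnt A k"
proof -
  have "nth_largest A r = sorted_list_of_set A ! (card A - Suc r)"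
    using assms by (simp add: nth_largest_def rev_nth)
  then show ?thesis
    using nth_less_iff[of A "card A - Suc r" k] assms below_cnt[OF assms(1), of k] by linarith
qed

lemma nth_largest_mem: "finite A \<Longrightarrow> r < card A \<Longrightarrow> nth_largest A r \<in> A"
  unfolding nth_largest_def
  by (metis length_rev length_sorted_list_of_set nth_mem set_rev set_sorted_list_of_set)

lemma nth_largest_bij: "finite A \<Longrightarrow> bij_betw (nth_largest A) {..<card A} A"
  unfolding nth_largest_def
  by (rule bij_betw_nth) auto

lemma nth_largest_less: 
  assumes "finite A" "r < s" "s < card A"
  shows "nth_largest A s < nth_largest A r"
proof -
  have "nth_largest A s \<le> nth_largest A r"
    using assms le_nth_largest_iff[OF assms(1), of s "nth_largest A s"]
      le_nth_largest_iff[OF assms(1), of r "nth_largest A s"] by simp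
  moreover have "nth_largest A s \<noteq> nth_largest A r"
    using inj_onD[OF bij_betw_imp_inj_on[OF nth_largest_bij[OF assms(1)]], of s r] assms(2,3) by auto
  ultimately show ?thesis by simp
qed

lemma nth_largest_mono:
  assumes "finite A" "finite B" "r < card A" "r < card B" "\<And>k. cnt A k \<le> cnt B k"
  shows "nth_largest A r \<le> nth_largest B r"
  using le_nth_largest_iff[OF assms(1,3), of "nth_largest A r"]
    le_nth_largest_iff[OF assms(2,4), of "nth_largest A r"] assms(5)[of "nth_largest A r"] by simp

section \<open>Columns and left key of a fixed tableau\<close>

context
  fixes \<alpha> :: composition and T :: "nat \<times> nat \<Rightarrow> nat"
  assumes T: "T \<in> RSSYT (sort_comp \<alpha>)"
begin

abbreviation col :: "nat \<Rightarrow> nat set" where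
  "col c \<equiv> column (sort_comp \<alpha>) T c"

lemma col_eq: "col c = (\<lambda>r. T (r, c)) ` {..<height \<alpha> c}"
  by (auto simp: column_def boxes_sort_comp)

lemma finite_col: "finite (col c)"
  by (simp add: col_eq)

lemma T_row: "r < height \<alpha> (Suc c) \<Longrightarrow> T (r, Suc c) \<le> T (r, c)"
  using T by (simp add: RSSYT_def boxes_sort_comp)

lemma T_col: "r < s \<Longrightarrow> s < height \<alpha> c \<Longrightarrow> T (s, c) < T (r, c)"
proof (induction s)
  case (Suc s)
  have "T (Suc s, c) < T (s, c)"
    using T Suc.prems(2) by (simp add: RSSYT_def boxes_sort_comp)
  then show ?case using Suc by (cases "r = s") auto
qed simp

lemma inj_on_col: "inj_on (\<lambda>r. T (r, c)) {..<height \<alpha> c}"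
  using T_col by (intro linorder_inj_onI) (auto, metis less_irrefl)

lemma card_col: "card (col c) = height \<alpha> c"
  by (simp add: col_eq card_image inj_on_col)

text \<open>Columns decrease strictly, so the rows with entry at least \<open>k\<close> form an
  initial interval.\<close>

lemma le_T_iff:
  assumes "r < height \<alpha> c"
  shows "k \<le> T (r, c) \<longleftrightarrow> r < cnt (col c) k"
proof -
  let ?S = "{r. r < height \<alpha> c \<and> k \<le> T (r, c)}"
  have "{x \<in> col c. k \<le> x} = (\<lambda>r. T (r, c)) ` ?S"
    by (auto simp: col_eq)
  moreover have "inj_on (\<lambda>r. T (r, c)) ?S"
    using inj_on_col by (rule inj_on_subset) auto
  ultimately have "cnt (col c) k = card ?S" by (simp add: cnt_def card_image)
  moreover have "r < card ?S \<longleftrightarrow> r \<in> ?S"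
  proof (rule less_card_iff_mem)
    fix x y assume "x \<in> ?S" "y \<le> x"
    then show "y \<in> ?S" using T_col[of y x c] by (cases "x = y") auto
  qed simp
  ultimately show ?thesis using assms by simp
qed

lemma T_eq_nth_largest:
  assumes "r < height \<alpha> c"
  shows "T (r, c) = nth_largest (col c) r"
proof (rule antisym)
  have r: "r < card (col c)" using assms by (simp add: card_col)
  show "T (r, c) \<le> nth_largest (col c) r"
    unfolding le_nth_largest_iff[OF finite_col r] using le_T_iff[OF assms] by blast
  show "nth_largest (col c) r \<le> T (r, c)"
    unfolding le_T_iff[OF assms] using le_nth_largest_iff[OF finite_col r] by blast
qed

lemma col_descending: "cnt (col (Suc c)) k \<le> cnt (col c) k"
proof (rule ccontr)
  \<comment> \<open>If the claim fails, \<open>?r\<close> is a row in which column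
    \<open>Suc c\<close> still has an entry at least \<open>k\<close> while column \<open>c\<close>
    no longer does, against the row condition.\<close>
  let ?r = "cnt (col c) k"
  assume "\<not> ?thesis"
  then have less: "?r < cnt (col (Suc c)) k" by simp
  then have r: "?r < height \<alpha> (Suc c)"
    using cnt_le_card[OF finite_col, of "Suc c" k] by (simp add: card_col)
  then have r': "?r < height \<alpha> c" using height_antimono[of c "Suc c" \<alpha>] by simp
  have "k \<le> T (?r, Suc c)" using le_T_iff[OF r] less by simp
  moreover have "\<not> k \<le> T (?r, c)" using le_T_iff[OF r'] by simp
  ultimately show False using T_row[OF r] by simp
qed

lemma col_empty: "width \<alpha> \<le> c \<Longrightarrow> col c = {}"
  using less_width_iff[of c \<alpha>] by (simp add: col_eq)

lemma descending_cols: "descending (map col [0..<n])"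
  unfolding descending_def
  by (auto simp: finite_col successively_conv_nth col_descending)

lemma card_left_key_column: "card (left_key_column (sort_comp \<alpha>) T c) = height \<alpha> c"
  unfolding left_key_column_def
  using tri_list_props[OF descending_cols[of "Suc c"]] by (simp add: card_col)

lemma left_key_column_subset: "left_key_column (sort_comp \<alpha>) T c \<subseteq> col 0"
  unfolding left_key_column_def
  using tri_list_props[OF descending_cols[of "Suc c"]] by (simp add: upt_rec[of 0] del: upt_Suc)

lemma finite_left_key_column: "finite (left_key_column (sort_comp \<alpha>) T c)"
  using left_key_column_subset finite_col by (rule finite_subset)

lemma left_key_column_antimono:
  "c \<le> d \<Longrightarrow> left_key_column (sort_comp \<alpha>) T d \<subseteq> left_key_column (sort_comp \<alpha>) T c"
proof (induction rule: dec_induct)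
  case (step d)
  have "left_key_column (sort_comp \<alpha>) T (Suc d) \<subseteq> left_key_column (sort_comp \<alpha>) T d"
    unfolding left_key_column_def
    using tri_list_append_subset[of "map col [0..<Suc d]" "col (Suc d)"]
      descending_cols[of "Suc (Suc d)"] by simp
  with step.IH show ?case by blast
qed simp

text \<open>Each column contains a given entry at most once, so projecting the boxes with entry
  \<open>a\<close> to their columns is injective.\<close>

lemma lookup_wt_left_key:
  "Poly_Mapping.lookup (wt (sort_comp \<alpha>) (left_key (sort_comp \<alpha>) T)) a =
    card {c. a \<in> left_key_column (sort_comp \<alpha>) T c}"
proof -
  let ?L = "left_key_column (sort_comp \<alpha>) T" and ?U = "left_key (sort_comp \<alpha>) T"
    and ?B = "boxes (sort_comp \<alpha>)"
  have U: "?U (r, c) = nth_largest (?L c) r" if "r < height \<alpha> c" for r c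
    using that by (simp add: left_key_def boxes_sort_comp nth_largest_def)
  have bij: "bij_betw (nth_largest (?L c)) {..<height \<alpha> c} (?L c)" for c
    using nth_largest_bij[OF finite_left_key_column, of c] by (simp add: card_left_key_column)
  have "Poly_Mapping.lookup (wt (sort_comp \<alpha>) ?U) a = (\<Sum>s\<in>?B. of_bool (?U s = a))"
    by (auto simp: wt_def lookup_sum lookup_single when_def intro!: sum.cong)
  also have "\<dots> = card {s \<in> ?B. ?U s = a}"
    using finite_boxes[of \<alpha>] by (simp add: Int_def)
  also have "\<dots> = card {c. a \<in> ?L c}"
  proof (rule bij_betw_same_card[of snd], rule bij_betw_imageI)
    show "inj_on snd {s \<in> ?B. ?U s = a}"
    proof (rule inj_onI)
      fix s t assume s: "s \<in> {s \<in> ?B. ?U s = a}" and t: "t \<in> {s \<in> ?B. ?U s = a}" and "snd s = snd t"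
      then obtain r r' c where eq: "s = (r, c)" "t = (r', c)" by (metis prod.collapse)
      then have "r < height \<alpha> c" "r' < height \<alpha> c" "nth_largest (?L c) r = nth_largest (?L c) r'"
        using s t U by (auto simp: boxes_sort_comp)
      then show "s = t" using eq bij_betw_imp_inj_on[OF bij, of c] by (auto dest: inj_onD)
    qed
    show "snd ` {s \<in> ?B. ?U s = a} = {c. a \<in> ?L c}"
    proof (intro equalityI subsetI)
      fix c assume "c \<in> snd ` {s \<in> ?B. ?U s = a}"
      then obtain r where "r < height \<alpha> c" "?U (r, c) = a" by (auto simp: boxes_sort_comp)
      then show "c \<in> {c. a \<in> ?L c}"
        using U nth_largest_mem[OF finite_left_key_column] card_left_key_column by auto
    next
      fix c assume "c \<in> {c. a \<in> ?L c}"
      then have "a \<in> nth_largest (?L c) ` {..<height \<alpha> c}"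
        using bij_betw_imp_surj_on[OF bij, of c] by simp
      then obtain r where "r < height \<alpha> c" "nth_largest (?L c) r = a" by auto
      then show "c \<in> snd ` {s \<in> ?B. ?U s = a}"
        using U by (auto simp: boxes_sort_comp image_iff intro!: bexI[of _ "(r, c)"])
    qed
  qed
  finally show ?thesis .
qed

text \<open>The columns are nested, so those containing \<open>a\<close> are an initial segment and
  are determined by their number. Identifying the left key with its weight therefore loses
  nothing.\<close>

lemma key_column_left_key:
  "key_column (wt (sort_comp \<alpha>) (left_key (sort_comp \<alpha>) T)) (Suc c) =
    left_key_column (sort_comp \<alpha>) T c"
proof -
  have "Suc c \<le> card {c. a \<in> left_key_column (sort_comp \<alpha>) T c} \<longleftrightarrow>
    a \<in> left_key_column (sort_comp \<alpha>) T c" for a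
  proof -
    let ?S = "{c. a \<in> left_key_column (sort_comp \<alpha>) T c}"
    have "c < card ?S \<longleftrightarrow> c \<in> ?S"
    proof (rule less_card_iff_mem)
      have "0 < height \<alpha> c" if "a \<in> left_key_column (sort_comp \<alpha>) T c" for c
        using that card_left_key_column[of c] finite_left_key_column[of c]
        by (metis card_gt_0_iff empty_iff)
      then have "?S \<subseteq> {..<width \<alpha>}" by (auto simp: less_width_iff)
      then show "finite ?S" by (rule finite_subset) simp
    qed (use left_key_column_antimono in blast)
    then show ?thesis by (simp add: Suc_le_eq)
  qed
  then show ?thesis by (auto simp: key_column_def lookup_wt_left_key)
qed

lemma key_le_left_key_iff:
  "key_le (wt (sort_comp \<alpha>) (left_key (sort_comp \<alpha>) T)) \<alpha> \<longleftrightarrow>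
    admissible (map (\<lambda>c. key_column \<alpha> (Suc c)) [0..<width \<alpha>]) (map col [0..<width \<alpha>])"
proof -
  let ?K = "wt (sort_comp \<alpha>) (left_key (sort_comp \<alpha>) T)"
    and ?L = "left_key_column (sort_comp \<alpha>) T"
  have "height ?K c = height \<alpha> c" for c
    unfolding height_def[of ?K] key_column_left_key by (rule card_left_key_column)
  then have "sort_comp ?K = sort_comp \<alpha>" by (simp add: sort_comp_eq_iff)
  then have "key_le ?K \<alpha> \<longleftrightarrow> (\<forall>j\<ge>1. \<forall>r<card (key_column ?K j).
        sorted_list_of_set (key_column ?K j) ! r \<le> sorted_list_of_set (key_column \<alpha> j) ! r)"
    by (simp add: key_le_def)
  also have "\<dots> \<longleftrightarrow> (\<forall>c. \<forall>r<card (key_column ?K (Suc c)).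
        sorted_list_of_set (key_column ?K (Suc c)) ! r \<le>
        sorted_list_of_set (key_column \<alpha> (Suc c)) ! r)"
    by (auto simp: Suc_le_eq gr0_conv_Suc)
  also have "\<dots> \<longleftrightarrow> (\<forall>c. dom_le (?L c) (key_column \<alpha> (Suc c)))"
    unfolding dom_le_iff_nth[OF finite_key_column] key_column_left_key
    by (simp add: finite_left_key_column card_left_key_column height_def[symmetric])
  also have "\<dots> \<longleftrightarrow> (\<forall>c<width \<alpha>. dom_le (?L c) (key_column \<alpha> (Suc c)))"
  proof -
    \<comment> \<open>The order compares all columns, the list only the first
      \<open>width \<alpha>\<close>; beyond these both columns are empty.\<close>
    have "dom_le (?L c) (key_column \<alpha> (Suc c))" if "\<not> c < width \<alpha>" for c
    proof -
      have "height \<alpha> c = 0" using that less_width_iff by blast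
      then have "?L c = {}" "key_column \<alpha> (Suc c) = {}"
        using finite_left_key_column[of c] card_left_key_column[of c] finite_key_column[of \<alpha> c]
        by (simp_all add: height_def)
      then show ?thesis by (simp add: dom_le_refl)
    qed
    then show ?thesis by blast
  qed
  also have "\<dots> \<longleftrightarrow>
    admissible (map (\<lambda>c. key_column \<alpha> (Suc c)) [0..<width \<alpha>]) (map col [0..<width \<alpha>])"
  proof (subst admissible_iff[OF chain_key_columns])
    have "take (Suc c) (map col [0..<width \<alpha>]) = map col [0..<Suc c]" if "c < width \<alpha>" for c
      using that by (simp add: take_map del: upt_Suc)
    then show "(\<forall>c<width \<alpha>. dom_le (?L c) (key_column \<alpha> (Suc c))) \<longleftrightarrow>
      length (map col [0..<width \<alpha>]) = length (map (\<lambda>c. key_column \<alpha> (Suc c)) [0..<width \<alpha>]) \<and>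
      descending (map col [0..<width \<alpha>]) \<and>
      (\<forall>c<length (map (\<lambda>c. key_column \<alpha> (Suc c)) [0..<width \<alpha>]).
        dom_le (tri_list (take (Suc c) (map col [0..<width \<alpha>])))
          (map (\<lambda>c. key_column \<alpha> (Suc c)) [0..<width \<alpha>] ! c))"
      using descending_cols by (simp add: left_key_column_def del: upt_Suc)
  qed
  finally show ?thesis .
qed

text \<open>Lowering an entry endangers only the inequalities with its right neighbour and with the
  box below it.\<close>

lemma upd_RSSYT_iff:
  assumes s: "r < height \<alpha> c" and k: "k < T (r, c)"
  shows "T((r, c) := k) \<in> RSSYT (sort_comp \<alpha>) \<longleftrightarrow>
    (r < height \<alpha> (Suc c) \<longrightarrow> T (r, Suc c) \<le> k) \<and> (Suc r < height \<alpha> c \<longrightarrow> T (Suc r, c) < k)"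
proof
  assume "T((r, c) := k) \<in> RSSYT (sort_comp \<alpha>)"
  then have rows: "\<And>r' c'. r' < height \<alpha> (Suc c') \<Longrightarrow> (T((r, c) := k)) (r', Suc c') \<le> (T((r, c) := k)) (r', c')"
    and cols: "\<And>r' c'. Suc r' < height \<alpha> c' \<Longrightarrow> (T((r, c) := k)) (Suc r', c') < (T((r, c) := k)) (r', c')"
    by (auto simp: RSSYT_def boxes_sort_comp simp del: fun_upd_apply)
  show "(r < height \<alpha> (Suc c) \<longrightarrow> T (r, Suc c) \<le> k) \<and> (Suc r < height \<alpha> c \<longrightarrow> T (Suc r, c) < k)"
    using rows[of r c] cols[of r c] by simp
next
  assume R: "(r < height \<alpha> (Suc c) \<longrightarrow> T (r, Suc c) \<le> k) \<and> (Suc r < height \<alpha> c \<longrightarrow> T (Suc r, c) < k)"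
  have "(T((r, c) := k)) (r', Suc c') \<le> (T((r, c) := k)) (r', c')" if "r' < height \<alpha> (Suc c')" for r' c'
  proof (cases "(r', Suc c') = (r, c)")
    case True
    then show ?thesis using T_row[OF that] k by simp
  next
    case False
    then show ?thesis using T_row[OF that] R that by (cases "(r', c') = (r, c)") auto
  qed
  moreover have "(T((r, c) := k)) (Suc r', c') < (T((r, c) := k)) (r', c')" if "Suc r' < height \<alpha> c'" for r' c'
  proof (cases "(Suc r', c') = (r, c)")
    case True
    then show ?thesis using T_col[of r' "Suc r'" c'] that k by simp
  next
    case False
    then show ?thesis using T_col[of r' "Suc r'" c'] R that by (cases "(r', c') = (r, c)") auto
  qed
  moreover have "T((r, c) := k) \<in> boxes (sort_comp \<alpha>) \<rightarrow>\<^sub>E UNIV"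
    using T s by (auto simp: RSSYT_def boxes_sort_comp PiE_iff extensional_def)
  ultimately show "T((r, c) := k) \<in> RSSYT (sort_comp \<alpha>)"
    by (simp add: RSSYT_def boxes_sort_comp)
qed

text \<open>In terms of counts the conditions read
  \<open>cnt (col (Suc c)) (Suc k) \<le> r < cnt (col c) (Suc k)\<close> and
  \<open>cnt (col c) k \<le> Suc r\<close>. They force \<open>k\<close> to be absent from the column
  and \<open>r\<close> to be the row of its smallest entry exceeding \<open>k\<close>.\<close>

lemma extension_iff:
  "(r, c) \<in> boxes (sort_comp \<alpha>) \<and> k < T (r, c) \<and> T((r, c) := k) \<in> RSSYT (sort_comp \<alpha>) \<longleftrightarrow>
    k \<in> extras (col c) (col (Suc c)) \<and> Suc r = cnt (col c) (Suc k)"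
proof (cases "r < height \<alpha> c")
  case True
  have "k < T (r, c) \<longleftrightarrow> r < cnt (col c) (Suc k)"
    using le_T_iff[OF True, of "Suc k"] by (simp add: Suc_le_eq)
  moreover have "(r < height \<alpha> (Suc c) \<longrightarrow> T (r, Suc c) \<le> k) \<longleftrightarrow> cnt (col (Suc c)) (Suc k) \<le> r"
    using le_T_iff[of r "Suc c" "Suc k"] cnt_le_card[OF finite_col, of "Suc c" "Suc k"]
    unfolding card_col by linarith
  moreover have "(Suc r < height \<alpha> c \<longrightarrow> T (Suc r, c) < k) \<longleftrightarrow> cnt (col c) k \<le> Suc r"
    using le_T_iff[of "Suc r" c k] cnt_le_card[OF finite_col, of c k]
    unfolding card_col by linarith
  ultimately show ?thesis
    using True upd_RSSYT_iff[OF True, of k] cnt_step[OF finite_col, of c k]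
    by (auto simp: boxes_sort_comp extras_def)
next
  case False
  then have "cnt (col c) (Suc k) \<noteq> Suc r"
    using cnt_le_card[OF finite_col, of c "Suc k"] by (simp add: card_col)
  with False show ?thesis by (auto simp: boxes_sort_comp)
qed

lemma prod_extensions:
  "(\<Prod>(s, k) | s \<in> boxes (sort_comp \<alpha>) \<and> k < T s \<and> T(s := k) \<in> RSSYT (sort_comp \<alpha>). f k) =
    (\<Prod>c<width \<alpha>. \<Prod>k\<in>extras (col c) (col (Suc c)). f k)"
proof -
  have "(\<Prod>(s, k) | s \<in> boxes (sort_comp \<alpha>) \<and> k < T s \<and> T(s := k) \<in> RSSYT (sort_comp \<alpha>). f k) =
    (\<Prod>(c, k)\<in>(SIGMA c:{..<width \<alpha>}. extras (col c) (col (Suc c))). f k)"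
  proof (rule prod.reindex_bij_witness[of _ "\<lambda>(c, k). ((cnt (col c) (Suc k) - 1, c), k)" "\<lambda>((r, c), k). (c, k)"])
    fix x assume "x \<in> {(s, k). s \<in> boxes (sort_comp \<alpha>) \<and> k < T s \<and> T(s := k) \<in> RSSYT (sort_comp \<alpha>)}"
    then obtain r c k where x: "x = ((r, c), k)"
      "(r, c) \<in> boxes (sort_comp \<alpha>) \<and> k < T (r, c) \<and> T((r, c) := k) \<in> RSSYT (sort_comp \<alpha>)"
      by (cases x) auto
    from x(2) have ex: "k \<in> extras (col c) (col (Suc c))" "Suc r = cnt (col c) (Suc k)"
      unfolding extension_iff by auto
    show "(\<lambda>(c, k). ((cnt (col c) (Suc k) - 1, c), k)) ((\<lambda>((r, c), k). (c, k)) x) = x"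
      by (simp add: x(1) flip: ex(2))
    show "(\<lambda>((r, c), k). (c, k)) x \<in> (SIGMA c:{..<width \<alpha>}. extras (col c) (col (Suc c)))"
      using x ex by (simp add: boxes_sort_comp less_width_iff)
    show "(\<lambda>(c, k). f k) ((\<lambda>((r, c), k). (c, k)) x) = (\<lambda>(s, k). f k) x"
      by (simp add: x(1))
  next
    fix y assume "y \<in> (SIGMA c:{..<width \<alpha>}. extras (col c) (col (Suc c)))"
    then obtain c k where y: "y = (c, k)" "k \<in> extras (col c) (col (Suc c))" by auto
    show "(\<lambda>((r, c), k). (c, k)) ((\<lambda>(c, k). ((cnt (col c) (Suc k) - 1, c), k)) y) = y"
      by (simp add: y(1))
    have "0 < cnt (col c) (Suc k)" using y(2) by (simp add: extras_def)
    then have "k \<in> extras (col c) (col (Suc c)) \<and> Suc (cnt (col c) (Suc k) - 1) = cnt (col c) (Suc k)"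
      using y(2) by simp
    then show "(\<lambda>(c, k). ((cnt (col c) (Suc k) - 1, c), k)) y
        \<in> {(s, k). s \<in> boxes (sort_comp \<alpha>) \<and> k < T s \<and> T(s := k) \<in> RSSYT (sort_comp \<alpha>)}"
      unfolding extension_iff[symmetric] by (simp add: y(1))
  qed
  also have "\<dots> = (\<Prod>c<width \<alpha>. \<Prod>k\<in>extras (col c) (col (Suc c)). f k)"
    by (subst prod.Sigma) (auto intro: finite_extras finite_col)
  finally show ?thesis .
qed

lemma monomial_wt: "monomial (wt (sort_comp \<alpha>) T) = (\<Prod>c<width \<alpha>. col_monom (col c))"
proof -
  have "monomial (wt (sort_comp \<alpha>) T) = (\<Prod>s\<in>boxes (sort_comp \<alpha>). var (T s))"
    by (simp add: wt_def monomial_sum var_def)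
  also have "\<dots> = (\<Prod>c<width \<alpha>. \<Prod>r<height \<alpha> c. var (T (r, c)))"
    by (rule prod_boxes)
  also have "\<dots> = (\<Prod>c<width \<alpha>. col_monom (col c))"
    by (simp add: col_monom_def col_eq prod.reindex inj_on_col)
  finally show ?thesis .
qed

end

text \<open>Regrouping attaches the factors of each column to that column rather than to its
  successor. The empty \<open>f b\<close> acts as right neighbour of the last column.\<close>

lemma list_weight_map:
  assumes "a \<le> b" "f b = {}"
  shows "list_weight C (map f [a..<b]) =
    col_weight C (f a) * (\<Prod>c\<in>{a..<b}. col_monom (f c) * col_weight (f c) (f (Suc c)))"
  using assms(1)
proof (induction arbitrary: C rule: inc_induct)
  case (step n)
  then show ?case
    by (simp add: upt_conv_Cons prod.atLeast_Suc_lessThan mult_ac del: upt_Suc)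
qed (simp add: assms(2))

text \<open>An initial interval has no gap below any of its elements. It can thus stand to the left
  of a tableau without contributing factors.\<close>

lemma extras_lessThan: "extras {..<n} D = {}"
proof -
  have "cnt {..<n} (Suc k) = 0" if "n \<le> k" for k
    using that by (intro cnt_eq_0) auto
  then show ?thesis by (auto simp: extras_def)
qed

lemma tableau_weight:
  assumes T: "T \<in> RSSYT (sort_comp \<alpha>)"
  shows "monomial (wt (sort_comp \<alpha>) T) *
      (\<Prod>(s, k) | s \<in> boxes (sort_comp \<alpha>) \<and> k < T s \<and> T(s := k) \<in> RSSYT (sort_comp \<alpha>).
        1 + beta * var k) =
    list_weight {..<n} (map (column (sort_comp \<alpha>) T) [0..<width \<alpha>])"
  unfolding prod_extensions[OF T] monomial_wt[OF T]
  by (subst list_weight_map)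
    (simp_all add: col_empty[OF T] col_weight_def extras_lessThan prod.distrib
      lessThan_atLeast0[of "width \<alpha>"])

lemma RSSYT_extensional:
  "T \<in> RSSYT (sort_comp \<alpha>) \<Longrightarrow> \<not> r < height \<alpha> c \<Longrightarrow> T (r, c) = undefined"
  by (auto simp: RSSYT_def boxes_sort_comp PiE_iff extensional_def)

text \<open>A tableau is recovered from its column sets by sorting each of them decreasingly; for
  the surjectivity, the row condition of the filling so obtained comes from
  \<open>nth_largest_mono\<close>.\<close>

lemma columns_bij_betw:
  "bij_betw (\<lambda>T. map (column (sort_comp \<alpha>) T) [0..<width \<alpha>])
    {T \<in> RSSYT (sort_comp \<alpha>). key_le (wt (sort_comp \<alpha>) (left_key (sort_comp \<alpha>) T)) \<alpha>}
    {Ds. admissible (map (\<lambda>c. key_column \<alpha> (Suc c)) [0..<width \<alpha>]) Ds}"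
  (is "bij_betw ?cols ?S {Ds. admissible ?Es Ds}")
proof (rule bij_betw_imageI)
  show "inj_on ?cols ?S"
  proof (rule inj_onI)
    fix T U assume "T \<in> ?S" "U \<in> ?S" and eq: "?cols T = ?cols U"
    then have T: "T \<in> RSSYT (sort_comp \<alpha>)" and U: "U \<in> RSSYT (sort_comp \<alpha>)" by auto
    have "T (r, c) = U (r, c)" for r c
    proof (cases "r < height \<alpha> c")
      case True
      then have "c < width \<alpha>" by (simp add: less_width_iff)
      with eq have "column (sort_comp \<alpha>) T c = column (sort_comp \<alpha>) U c" by simp
      then show ?thesis using T_eq_nth_largest[OF T True] T_eq_nth_largest[OF U True] by simp
    qed (simp add: RSSYT_extensional[OF T] RSSYT_extensional[OF U])
    then show "T = U" by (intro ext) (metis surj_pair)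
  qed
  show "?cols ` ?S = {Ds. admissible ?Es Ds}"
  proof (intro equalityI subsetI)
    fix Ds assume "Ds \<in> ?cols ` ?S"
    then obtain T where "T \<in> ?S" "Ds = ?cols T" by (rule imageE)
    then show "Ds \<in> {Ds. admissible ?Es Ds}" using key_le_left_key_iff[of T \<alpha>] by simp
  next
    fix Ds assume "Ds \<in> {Ds. admissible ?Es Ds}"
    then have adm: "admissible ?Es Ds" by simp
    then have len: "length Ds = width \<alpha>" and desc: "descending Ds"
      and le: "\<And>c. c < width \<alpha> \<Longrightarrow> dom_le (tri_list (take (Suc c) Ds)) (key_column \<alpha> (Suc c))"
      unfolding admissible_iff[OF chain_key_columns] by simp_all
    have fin: "finite (Ds ! c)" if "c < width \<alpha>" for c
      using desc len that by (simp add: descending_def)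
    \<comment> \<open>The bound fixes the size of the key column, which by
      \<open>tri_list_props\<close> is the size of the last column entering it.\<close>
    have card: "card (Ds ! c) = height \<alpha> c" if "c < width \<alpha>" for c
    proof -
      have "last (take (Suc c) Ds) = Ds ! c" using that len by (simp add: take_Suc_conv_app_nth)
      moreover have "take (Suc c) Ds \<noteq> []" using that len by auto
      ultimately show ?thesis
        using tri_list_props[OF descending_take[OF desc, of "Suc c"]] dom_leD(2)[OF le[OF that]]
        by (simp add: height_def)
    qed
    have dec: "cnt (Ds ! Suc c) k \<le> cnt (Ds ! c) k" if "Suc c < width \<alpha>" for c k
      using desc that len by (simp add: descending_def successively_conv_nth)
    define T where "T = (\<lambda>(r, c)\<in>boxes (sort_comp \<alpha>). nth_largest (Ds ! c) r)"
    have T_eq: "T (r, c) = nth_largest (Ds ! c) r" if "r < height \<alpha> c" for r c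
      using that by (simp add: T_def boxes_sort_comp)
    have w: "c < width \<alpha>" if "r < height \<alpha> c" for r c
      using that by (simp add: less_width_iff)
    have T: "T \<in> RSSYT (sort_comp \<alpha>)"
    proof -
      have rows: "T (r, Suc c) \<le> T (r, c)" if "r < height \<alpha> (Suc c)" for r c
      proof -
        have r: "r < height \<alpha> c" using that height_antimono[of c "Suc c" \<alpha>] by simp
        show ?thesis
          unfolding T_eq[OF r] T_eq[OF that]
          using fin[OF w[OF r]] fin[OF w[OF that]] card[OF w[OF r]] card[OF w[OF that]] r that
            dec[OF w[OF that]] by (intro nth_largest_mono) auto
      qed
      have cols: "T (Suc r, c) < T (r, c)" if "Suc r < height \<alpha> c" for r c
      proof -
        have r: "r < height \<alpha> c" using that by simp
        show ?thesis
          unfolding T_eq[OF r] T_eq[OF that]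
          using fin[OF w[OF r]] card[OF w[OF r]] that by (intro nth_largest_less) auto
      qed
      have "T \<in> boxes (sort_comp \<alpha>) \<rightarrow>\<^sub>E UNIV" unfolding T_def by simp
      with rows cols show ?thesis unfolding RSSYT_def boxes_sort_comp by blast
    qed
    have col: "column (sort_comp \<alpha>) T c = Ds ! c" if "c < width \<alpha>" for c
    proof -
      have "column (sort_comp \<alpha>) T c = (\<lambda>r. T (r, c)) ` {..<height \<alpha> c}"
        by (rule col_eq[OF T])
      also have "\<dots> = nth_largest (Ds ! c) ` {..<card (Ds ! c)}"
        using T_eq by (simp add: card[OF that])
      also have "\<dots> = Ds ! c"
        using nth_largest_bij[OF fin[OF that]] by (rule bij_betw_imp_surj_on)
      finally show ?thesis .
    qed
    have cols: "?cols T = Ds"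
    proof (rule nth_equalityI)
      show "length (?cols T) = length Ds" using len by simp
      show "?cols T ! c = Ds ! c" if "c < length (?cols T)" for c
        using that col by simp
    qed
    have "T \<in> ?S" using T adm unfolding mem_Collect_eq key_le_left_key_iff[OF T] cols by blast
    then have "?cols T \<in> ?cols ` ?S" by (rule imageI)
    then show "Ds \<in> ?cols ` ?S" unfolding cols .
  qed
qed

subsection \<open>The recursion for the tableau sums\<close>

definition tableau_sum :: "composition \<Rightarrow> beta_mpoly" where
  "tableau_sum \<alpha> =
    (\<Sum>T | T \<in> RSSYT (sort_comp \<alpha>) \<and> key_le (wt (sort_comp \<alpha>) (left_key (sort_comp \<alpha>) T)) \<alpha>.
       monomial (wt (sort_comp \<alpha>) T) *
       (\<Prod>(s, k) | s \<in> boxes (sort_comp \<alpha>) \<and> k < T s \<and> T(s := k) \<in> RSSYT (sort_comp \<alpha>).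
          1 + beta * var k))"

text \<open>The interval in front contributes no factor, so \<open>n\<close> is arbitrary and can
  later be taken large enough for \<open>Phi_swap\<close>.\<close>

lemma tableau_sum_eq_Phi:
  "tableau_sum \<alpha> = Phi {..<n} (map (\<lambda>c. key_column \<alpha> (Suc c)) [0..<width \<alpha>])"
proof -
  let ?S = "{T. T \<in> RSSYT (sort_comp \<alpha>) \<and> key_le (wt (sort_comp \<alpha>) (left_key (sort_comp \<alpha>) T)) \<alpha>}"
  have "tableau_sum \<alpha> =
    (\<Sum>T\<in>?S. list_weight {..<n} (map (column (sort_comp \<alpha>) T) [0..<width \<alpha>]))"
    unfolding tableau_sum_def by (intro sum.cong refl tableau_weight) simp
  also have "\<dots> = Phi {..<n} (map (\<lambda>c. key_column \<alpha> (Suc c)) [0..<width \<alpha>])"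
    unfolding Phi_eq_sum(2)[OF chain_key_columns(2)]
    by (rule sum.reindex_bij_betw) (rule columns_bij_betw)
  finally show ?thesis .
qed

text \<open>Among the sets with \<open>p\<close> elements, \<open>{..<p}\<close> is the least: no
  such set has more elements below any \<open>k\<close>.\<close>

lemma dom_le_lessThan_iff: "dom_le D {..<p} \<longleftrightarrow> D = {..<p}"
proof
  assume D: "dom_le D {..<p}"
  note fin = dom_leD(1)[OF D]
  have "cnt {..<p} k \<le> cnt D k" for k
  proof -
    have "card {x \<in> D. x < k} \<le> card {..<k}" by (intro card_mono) auto
    moreover have "{x \<in> {..<p}. x < k} = {..<min p k}" by auto
    moreover have "card {x \<in> D. x < k} \<le> p"
      using card_mono[OF fin, of "{x \<in> D. x < k}"] dom_leD(2)[OF D] by auto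
    ultimately have "card {x \<in> D. x < k} \<le> card {x \<in> {..<p}. x < k}" by simp
    then show ?thesis
      using card_below[OF fin, of k] card_below[of "{..<p}" k] dom_leD(2)[OF D] by simp
  qed
  then have "dom_le {..<p} D" using dom_leD(2)[OF D] by (simp add: dom_le_def)
  with D show "D = {..<p}" by (rule dom_le_antisym)
qed (simp add: dom_le_refl)

text \<open>By \<open>dom_le_lessThan_iff\<close> each of the nested sums has a single term, and
  \<open>cap\<close> leaves the remaining intervals unchanged.\<close>

lemma Phi_lessThan:
  "sorted_wrt (\<ge>) ps \<Longrightarrow> Phi {..<n} (map lessThan ps) = (\<Prod>p\<leftarrow>ps. col_monom {..<p})"
proof (induction ps arbitrary: n)
  case (Cons p ps)
  have "cap {..<p} {..<q} = {..<q}" if "q \<in> set ps" for q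
  proof -
    have "dom_le (cap {..<p} {..<q}) {..<q}"
      using that Cons.prems by (intro cap_dom_le'[of _ "{..<p}"]) (auto simp: dom_le_refl)
    then show ?thesis by (simp add: dom_le_lessThan_iff)
  qed
  then have "map (cap {..<p}) (map lessThan ps) = map lessThan ps" by simp
  moreover have "{D. dom_le D {..<p}} = {{..<p}}" by (auto simp: dom_le_lessThan_iff)
  ultimately show ?case
    using Cons by (simp add: col_weight_def extras_lessThan del: map_map)
qed (simp add: col_weight_def extras_lessThan)

lemma less_width: "c < Poly_Mapping.lookup \<alpha> i \<Longrightarrow> c < width \<alpha>"
  unfolding less_width_iff height_def card_gt_0_iff
  using finite_key_column by (auto simp: key_column_def Suc_le_eq)

lemma monomial_eq_prod: "monomial \<alpha> = (\<Prod>c<width \<alpha>. col_monom (key_column \<alpha> (Suc c)))"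
proof -
  have "\<alpha> = (\<Sum>c<width \<alpha>. \<Sum>i\<in>key_column \<alpha> (Suc c). Poly_Mapping.single i 1)"
  proof (rule poly_mapping_eqI)
    fix j
    have inner: "Poly_Mapping.lookup (\<Sum>i\<in>key_column \<alpha> (Suc c). Poly_Mapping.single i 1) j =
      (of_bool (c < Poly_Mapping.lookup \<alpha> j) :: nat)" for c
    proof -
      have "Poly_Mapping.lookup (\<Sum>i\<in>key_column \<alpha> (Suc c). Poly_Mapping.single i 1) j =
        (of_bool (j \<in> key_column \<alpha> (Suc c)) :: nat)"
        by (simp add: lookup_sum lookup_single when_def finite_key_column)
      then show ?thesis by (simp add: key_column_def Suc_le_eq)
    qed
    have "Poly_Mapping.lookup (\<Sum>c<width \<alpha>. \<Sum>i\<in>key_column \<alpha> (Suc c). Poly_Mapping.single i 1) j =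
      (\<Sum>c<width \<alpha>. of_bool (c < Poly_Mapping.lookup \<alpha> j) :: nat)"
      by (subst lookup_sum) (simp only: inner)
    also have "\<dots> = card ({..<width \<alpha>} \<inter> {c. c < Poly_Mapping.lookup \<alpha> j})" by simp
    also have "{..<width \<alpha>} \<inter> {c. c < Poly_Mapping.lookup \<alpha> j} = {..<Poly_Mapping.lookup \<alpha> j}"
      using less_width[of _ \<alpha> j] by blast
    finally show "Poly_Mapping.lookup \<alpha> j = Poly_Mapping.lookup
      (\<Sum>c<width \<alpha>. \<Sum>i\<in>key_column \<alpha> (Suc c). Poly_Mapping.single i 1) j" by simp
  qed
  then have "monomial \<alpha> = monomial (\<Sum>c<width \<alpha>. \<Sum>i\<in>key_column \<alpha> (Suc c). Poly_Mapping.single i 1)"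
    by simp
  also have "\<dots> = (\<Prod>c<width \<alpha>. col_monom (key_column \<alpha> (Suc c)))"
    by (simp add: monomial_sum col_monom_def var_def)
  finally show ?thesis .
qed

lemma key_column_partition:
  assumes "is_partition \<alpha>"
  shows "key_column \<alpha> (Suc c) = {..<height \<alpha> c}"
proof -
  have anti: "Poly_Mapping.lookup \<alpha> y \<le> Poly_Mapping.lookup \<alpha> x" if "x \<le> y" for x y
  proof (rule lift_Suc_antimono_le[of "Poly_Mapping.lookup \<alpha>"])
    show "Poly_Mapping.lookup \<alpha> (Suc n) \<le> Poly_Mapping.lookup \<alpha> n" for n
      using assms by (simp add: is_partition_def)
  qed (rule that)
  have "x < card (key_column \<alpha> (Suc c)) \<longleftrightarrow> x \<in> key_column \<alpha> (Suc c)" for x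
  proof (rule less_card_iff_mem[OF finite_key_column])
    fix x y assume "x \<in> key_column \<alpha> (Suc c)" "y \<le> x"
    then show "y \<in> key_column \<alpha> (Suc c)"
      using anti[of y x] unfolding key_column_def by simp
  qed
  then show ?thesis unfolding height_def by blast
qed

lemma tableau_sum_partition:
  assumes "is_partition \<alpha>"
  shows "tableau_sum \<alpha> = monomial \<alpha>"
proof -
  have "tableau_sum \<alpha> = Phi {..<0} (map lessThan (map (height \<alpha>) [0..<width \<alpha>]))"
    using tableau_sum_eq_Phi[of \<alpha> 0] by (simp add: key_column_partition[OF assms] comp_def)
  also have "\<dots> = (\<Prod>p\<leftarrow>map (height \<alpha>) [0..<width \<alpha>]. col_monom {..<p})"
    by (intro Phi_lessThan) (auto simp: sorted_wrt_iff_nth_less height_antimono)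
  also have "\<dots> = (\<Prod>c<width \<alpha>. col_monom {..<height \<alpha> c})"
    by (simp add: prod.list_conv_set_nth lessThan_atLeast0)
  finally show ?thesis by (simp add: monomial_eq_prod key_column_partition[OF assms])
qed

lemma key_column_swap_comp: "key_column (swap_comp i \<alpha>) j = sw i (key_column \<alpha> j)"
  by (auto simp: key_column_def lookup_swap_comp mem_sw)

lemma tableau_sum_ascent:
  assumes "Poly_Mapping.lookup \<alpha> i < Poly_Mapping.lookup \<alpha> (Suc i)"
  shows "tableau_sum \<alpha> = demazure_lascoux i (tableau_sum (swap_comp i \<alpha>))"
proof -
  let ?\<gamma> = "swap_comp i \<alpha>"
  let ?Es = "map (\<lambda>c. key_column ?\<gamma> (Suc c)) [0..<width ?\<gamma>]"
  \<comment> \<open>The interval \<open>{..<n}\<close> must contain both letters and all bounding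
    columns to meet the first case of \<open>Phi_swap\<close>.\<close>
  obtain n where n: "\<And>x. x \<in> Poly_Mapping.keys ?\<gamma> \<Longrightarrow> x < n" "\<And>x. x \<in> {i, Suc i} \<Longrightarrow> x < n"
    using finite_bounded[of "Poly_Mapping.keys ?\<gamma>" "{i, Suc i}"] by (metis finite.emptyI finite_insert finite_keys)
  have "height ?\<gamma> c = height \<alpha> c" for c
    by (simp add: height_def key_column_swap_comp)
  then have "sort_comp ?\<gamma> = sort_comp \<alpha>" by (simp add: sort_comp_eq_iff)
  then have "width ?\<gamma> = width \<alpha>" by (simp add: width_def)
  then have Es: "map (\<lambda>c. key_column \<alpha> (Suc c)) [0..<width \<alpha>] = map (sw i) ?Es"
    by (simp add: key_column_swap_comp comp_def)
  have sub: "key_column ?\<gamma> (Suc c) \<subseteq> {..<n}" for c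
  proof
    fix x assume "x \<in> key_column ?\<gamma> (Suc c)"
    then have "x \<in> Poly_Mapping.keys ?\<gamma>" by (simp add: key_column_def in_keys_iff)
    then show "x \<in> {..<n}" using n(1) by simp
  qed
  have chain: "chain_below {..<n} ?Es"
    unfolding chain_below_def using chain_key_columns(1)[of ?\<gamma>] sub by simp
  have asc: "\<forall>F\<in>set ?Es. Suc i \<in> F \<longrightarrow> i \<in> F"
    using assms by (simp add: key_column_def lookup_swap_comp)
  have "Phi {..<n} (map (sw i) ?Es) = demazure_lascoux i (Phi {..<n} ?Es)"
    using Phi_swap[of "{..<n}" ?Es i] chain asc n(2) by blast
  then show ?thesis
    by (simp only: tableau_sum_eq_Phi[of \<alpha> n] tableau_sum_eq_Phi[of ?\<gamma> n] Es)
qed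

section \<open>Uniqueness of the solution of the Lascoux recursion\<close>

definition position_sum :: "composition \<Rightarrow> nat" where
  "position_sum \<alpha> = (\<Sum>j\<in>Poly_Mapping.keys \<alpha>. j * Poly_Mapping.lookup \<alpha> j)"

text \<open>Moving the larger part one place to the left lowers the sum by the difference of the two
  parts; all other positions keep their contribution.\<close>

lemma position_sum_swap_less:
  assumes "Poly_Mapping.lookup \<alpha> i < Poly_Mapping.lookup \<alpha> (Suc i)"
  shows "position_sum (swap_comp i \<alpha>) < position_sum \<alpha>"
proof -
  let ?\<gamma> = "swap_comp i \<alpha>"
  let ?A = "(Poly_Mapping.keys \<alpha> \<union> Poly_Mapping.keys ?\<gamma>) - {i, Suc i}"
  have eq: "position_sum \<delta> = i * Poly_Mapping.lookup \<delta> i + Suc i * Poly_Mapping.lookup \<delta> (Suc i) +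
      (\<Sum>j\<in>?A. j * Poly_Mapping.lookup \<delta> j)" if "\<delta> = \<alpha> \<or> \<delta> = ?\<gamma>" for \<delta>
  proof -
    have "position_sum \<delta> = (\<Sum>j\<in>{i, Suc i} \<union> ?A. j * Poly_Mapping.lookup \<delta> j)"
      unfolding position_sum_def using that
      by (intro sum.mono_neutral_left) (auto simp: in_keys_iff)
    also have "\<dots> = (\<Sum>j\<in>{i, Suc i}. j * Poly_Mapping.lookup \<delta> j) +
        (\<Sum>j\<in>?A. j * Poly_Mapping.lookup \<delta> j)"
      by (intro sum.union_disjoint) auto
    finally show ?thesis by simp
  qed
  have "(\<Sum>j\<in>?A. j * Poly_Mapping.lookup ?\<gamma> j) = (\<Sum>j\<in>?A. j * Poly_Mapping.lookup \<alpha> j)"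
    by (intro sum.cong) (auto simp: lookup_swap_comp transpose_def)
  then show ?thesis
    using eq[of \<alpha>] eq[of ?\<gamma>] assms by (simp add: lookup_swap_comp)
qed

lemma lascoux_family_unique:
  assumes "lascoux_family L" "lascoux_family M"
  shows "L \<alpha> = M \<alpha>"
proof (induction \<alpha> rule: measure_induct_rule[where f = position_sum])
  case (less \<alpha>)
  show ?case
  proof (cases "is_partition \<alpha>")
    case True
    then show ?thesis using assms by (simp add: lascoux_family_def)
  next
    case False
    then obtain i where i: "Poly_Mapping.lookup \<alpha> i < Poly_Mapping.lookup \<alpha> (Suc i)"
      by (auto simp: is_partition_def not_le)
    then have "L (swap_comp i \<alpha>) = M (swap_comp i \<alpha>)"
      by (intro less position_sum_swap_less)
    with assms i show ?thesis by (simp add: lascoux_family_def)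
  qed
qed

theorem theorem1p3:
  fixes \<alpha> :: composition
  shows "lascoux \<alpha> =
    (\<Sum>T | T \<in> RSSYT (sort_comp \<alpha>) \<and> key_le (wt (sort_comp \<alpha>) (left_key (sort_comp \<alpha>) T)) \<alpha>.
       monomial (wt (sort_comp \<alpha>) T) *
       (\<Prod>(s, k) | s \<in> boxes (sort_comp \<alpha>) \<and> k < T s \<and> T(s := k) \<in> RSSYT (sort_comp \<alpha>).
          1 + beta * var k))"
proof -
  have "lascoux_family tableau_sum"
    by (simp add: lascoux_family_def tableau_sum_partition tableau_sum_ascent)
  \<comment> \<open>The tableau sums themselves provide the existence required by the definite
    description.\<close>
  then have "lascoux = tableau_sum"
    unfolding lascoux_def by (intro the_equality ext lascoux_family_unique)
  then show ?thesis by (simp only: tableau_sum_def)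
qed

end
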